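(* Let $F$ be a number field. (i) Let $D,D'$ be reduced divisors, viewed in $\widetilde{\rm Div}^0_F$. If there exists $f\in F^*_+$ such that $D-D'+(f)=(O_F,v)$ with $|\log(v_\sigma)|<\log(4/3)$ for every infinite prime $\sigma$, then $D=D'$ in $\widetilde{\rm Div}^0_F$. Similarly, if there exists $f\in F^*_+$ with $D-D'+(f)=(O_F,v)$ and $\|v\|_{\widetilde{\rm Pic}}<\log(4/3)$, then $D=D'$. (ii) The natural map from the disjoint union over $D'\in{\rm Red}_F$ of the sets $$\{D'+(O_F,v):\ v\in(F^*_{\mathbb{R},\rm conn})^0,\ |\log(v_\sigma)|<\tfrac12\log(4/3)\text{ for each }\sigma\}$$ to $\widetilde{\rm Pic}^0_F$ is injective.
   Context: Let $F$ be a number field of degree $n$, ring of integers $O_F$. An infinite prime is an embedding $\sigma:F\to\mathbb{C}$ up to complex conjugation; $\deg\sigma=1$ if real, $2$ if complex; $F_\sigma=\mathbb{R}$ or $\mathbb{C}$ accordingly, and $F_\mathbb{R}=F\otimes_\mathbb{Q}\mathbb{R}\cong\prod_\sigma F_\sigma$ via $f\mapsto(\sigma(f))_\sigma$. For $y\in F_\mathbb{R}$, $\|y\|^2=\sum_\sigma\deg(\sigma)|y_\sigma|^2$; $\exp$ and $\log$ act coordinatewise, $\log$ being the principal branch. An oriented Arakelov divisor is a pair $(I,u)$ with $I$ a nonzero fractional ideal and $u\in F_\mathbb{R}^*$; they form a group $\widetilde{\rm Div}_F$ under $(I,u)+(J,w)=(IJ,uw)$; the principal oriented divisor of $f\in F^*$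 is $(f)=(f^{-1}O_F,f)$ with $f$ viewed in $F_\mathbb{R}^*$; the degree of $(I,u)$ is $-\log(N(I)\prod_\sigma|u_\sigma|^{\deg\sigma})$; $\widetilde{\rm Div}^0_F$ is the degree-zero subgroup and $\widetilde{\rm Pic}^0_F$ its quotient by principal oriented divisors. $F^*_+=\{x\in F^*:\sigma(x)>0\text{ for all real }\sigma\}$, $O^*_{F,+}=O_F^*\cap F^*_+$, $F^*_{\mathbb{R},\rm conn}=\{u\in F_\mathbb{R}^*:u_\sigma>0\text{ for real }\sigma\}$ and $(F^*_{\mathbb{R},\rm conn})^0$ its elements with $\prod_\sigma|u_\sigma|^{\deg\sigma}=1$. For $v\in F^*_{\mathbb{R},\rm conn}$, $\|v\|_{\widetilde{\rm Pic}}=\min\{\|y\|:y\in F_\mathbb{R},\ \exp(y)\in vO^*_{F,+}\}$. For a fractional ideal $I$, $d(I)=(I,N(I)^{-1/n})$. A nonzero $f\in I$ is minimal if the only $g\in I$ with $|\sigma(g)|<|\sigma(f)|$ for all $\sigma$ is $g=0$. A reduced divisor is one of the form $d(I)$ with $1\in I$ minimal; ${\rm Red}_F$ is the set of them. *)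

theory Defs
  imports
    "HOL-Analysis.Analysis"
    "HOL-Computational_Algebra.Polynomial"
    "HOL-Algebra.Coset"
begin

section \<open>Number fields\<close>

text \<open>
  Finite-dimensionality over the rationals, written with \<open>of_int\<close> because \<open>of_rat\<close> is not a
  class-local constant: each \<open>x\<close> is a linear combination of \<open>B\<close> with rational coefficients
  \<open>p b / q b\<close> (a coefficient with \<open>q b = 0\<close> is \<open>0\<close>).
\<close>

class number_field = field_char_0 +
  assumes finite_over_rat:
    "\<exists>B. finite B \<and> (\<forall>x. \<exists>p q. x = (\<Sum>b\<in>B. of_int (p b) / of_int (q b) * b))"

instance rat :: number_field
proof
  have "\<exists>p q. x = (\<Sum>b\<in>{1::rat}. of_int (p b) / of_int (q b) * b)" for x :: rat
  proof (cases x)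
    case (Fract a b)
    then show ?thesis
      by (intro exI[of _ "\<lambda>_. a"] exI[of _ "\<lambda>_. b"]) (simp add: Fract_of_int_quotient)
  qed
  then show "\<exists>B. finite B \<and>
      (\<forall>x::rat. \<exists>p q. x = (\<Sum>b\<in>B. of_int (p b) / of_int (q b) * b))"
    by (intro exI[of _ "{1}"]) auto
qed

definition field_degree :: "'a::number_field itself \<Rightarrow> nat" where
  "field_degree _ = vector_space.dim (\<lambda>(q::rat) x. of_rat q * x) (UNIV :: 'a set)"

definition ring_of_integers :: "'a::number_field set" where
  "ring_of_integers = {x. algebraic_int x}"

definition unit_group :: "'a::number_field set" where
  "unit_group = {x \<in> ring_of_integers. x \<noteq> 0 \<and> inverse x \<in> ring_of_integers}"

definition embeddings :: "('a::number_field \<Rightarrow> complex) set" where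
  "embeddings = {\<sigma>. \<sigma> 1 = 1 \<and> (\<forall>x y. \<sigma> (x + y) = \<sigma> x + \<sigma> y) \<and> (\<forall>x y. \<sigma> (x * y) = \<sigma> x * \<sigma> y)}"


section \<open>Infinite primes and the algebra $F_{\bf R}$\<close>

text \<open>
  An infinite prime is a class \<open>{\<sigma>, cnj \<circ> \<sigma>}\<close>. The isomorphism of $F_{\bf R}$ with the product of
  the completions depends on a representative of each class, here \<open>prime_embedding P\<close>; only the
  properties of a representative are ever used.
\<close>

definition infinite_primes :: "('a::number_field \<Rightarrow> complex) set set" where
  "infinite_primes =
     embeddings // {(\<sigma>, \<tau>). \<sigma> \<in> embeddings \<and> (\<tau> = \<sigma> \<or> \<tau> = cnj \<circ> \<sigma>)}"

definition prime_embedding :: "('a::number_field \<Rightarrow> complex) set \<Rightarrow> 'a \<Rightarrow> complex" where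
  "prime_embedding P = (SOME \<sigma>. \<sigma> \<in> P)"

definition real_prime :: "('a::number_field \<Rightarrow> complex) set \<Rightarrow> bool" where
  "real_prime P \<longleftrightarrow> range (prime_embedding P) \<subseteq> \<real>"

definition prime_degree :: "('a::number_field \<Rightarrow> complex) set \<Rightarrow> nat" where
  "prime_degree P = (if real_prime P then 1 else 2)"

definition completion :: "('a::number_field \<Rightarrow> complex) set \<Rightarrow> complex set" where
  "completion P = (if real_prime P then \<real> else UNIV)"

type_synonym 'a FR = "('a \<Rightarrow> complex) set \<Rightarrow> complex"

definition FR :: "'a::number_field FR set" where
  "FR = (\<Pi>\<^sub>E P\<in>infinite_primes. completion P)"

definition FR_units :: "'a::number_field FR set" where
  "FR_units = (\<Pi>\<^sub>E P\<in>infinite_primes. completion P - {0})"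

definition FR_mult :: "'a::number_field FR \<Rightarrow> 'a FR \<Rightarrow> 'a FR" where
  "FR_mult u w = (\<lambda>P\<in>infinite_primes. u P * w P)"

definition FR_exp :: "'a::number_field FR \<Rightarrow> 'a FR" where
  "FR_exp y = (\<lambda>P\<in>infinite_primes. exp (y P))"

definition FR_norm :: "'a::number_field FR \<Rightarrow> real" where
  "FR_norm y = sqrt (\<Sum>P\<in>infinite_primes. real (prime_degree P) * (cmod (y P))\<^sup>2)"

definition to_FR :: "'a::number_field \<Rightarrow> 'a FR" where
  "to_FR f = (\<lambda>P\<in>infinite_primes. prime_embedding P f)"

text \<open>At a real prime the coordinates are real, so \<open>Re\<close> merely casts them to type \<^typ>\<open>real\<close>.\<close>

definition totally_positive :: "'a::number_field set" where
  "totally_positive =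
     {x. x \<noteq> 0 \<and> (\<forall>P\<in>infinite_primes. real_prime P \<longrightarrow> Re (prime_embedding P x) > 0)}"

definition FR_conn :: "'a::number_field FR set" where
  "FR_conn = {u \<in> FR_units. \<forall>P\<in>infinite_primes. real_prime P \<longrightarrow> Re (u P) > 0}"

definition FR_conn0 :: "'a::number_field FR set" where
  "FR_conn0 = {u \<in> FR_conn. (\<Prod>P\<in>infinite_primes. cmod (u P) ^ prime_degree P) = 1}"

text \<open>The infimum is a minimum: the admissible \<open>y\<close> form a translate of a discrete subgroup.\<close>

definition Pic_norm :: "'a::number_field FR \<Rightarrow> real" where
  "Pic_norm v = Inf (FR_norm ` {y \<in> FR. \<exists>e \<in> unit_group \<inter> totally_positive.
                                   FR_exp y = FR_mult v (to_FR e)})"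


section \<open>Fractional ideals\<close>

definition fractional_ideal :: "'a::number_field set \<Rightarrow> bool" where
  "fractional_ideal I \<longleftrightarrow>
     0 \<in> I \<and> I \<noteq> {0} \<and>
     (\<forall>x\<in>I. \<forall>y\<in>I. x + y \<in> I) \<and>
     (\<forall>a\<in>ring_of_integers. \<forall>x\<in>I. a * x \<in> I) \<and>
     (\<exists>d\<in>ring_of_integers. d \<noteq> 0 \<and> (\<forall>x\<in>I. d * x \<in> ring_of_integers))"

definition ideal_mult :: "'a::number_field set \<Rightarrow> 'a set \<Rightarrow> 'a set" where
  "ideal_mult I J =
     {\<Sum>i<k. a i * b i | (k::nat) a b. (\<forall>i<k. a i \<in> I) \<and> (\<forall>i<k. b i \<in> J)}"

definition principal_ideal :: "'a::number_field \<Rightarrow> 'a set" where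
  "principal_ideal f = (*) f ` ring_of_integers"

text \<open>
  $N(I) = [O_F : dI] / d^n$ for a positive integer $d$ with $dI \subseteq O_F$; the value does not
  depend on $d$.
\<close>

definition ideal_norm :: "'a::number_field set \<Rightarrow> real" where
  "ideal_norm I =
     (let d = (LEAST d::nat. d > 0 \<and> (\<forall>x\<in>I. of_nat d * x \<in> ring_of_integers));
          dI = (*) (of_nat d) ` I
      in real (card (ring_of_integers //
              {(x, y). x \<in> ring_of_integers \<and> y \<in> ring_of_integers \<and> x - y \<in> dI}))
         / real d ^ field_degree TYPE('a))"

definition minimal_in :: "'a::number_field set \<Rightarrow> 'a \<Rightarrow> bool" where
  "minimal_in I f \<longleftrightarrow> f \<in> I \<and> f \<noteq> 0 \<and>
     (\<forall>g\<in>I. (\<forall>P\<in>infinite_primes. cmod (prime_embedding P g) < cmod (prime_embedding P f))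
        \<longrightarrow> g = 0)"


section \<open>Oriented Arakelov divisors\<close>

type_synonym 'a odivisor = "'a set \<times> 'a FR"

text \<open>The group is written multiplicatively, as is usual in \<^theory>\<open>HOL-Algebra.Group\<close>.\<close>

definition oDiv :: "'a::number_field odivisor monoid" where
  "oDiv = \<lparr>carrier = {I. fractional_ideal I} \<times> FR_units,
           mult = (\<lambda>(I, u) (J, w). (ideal_mult I J, FR_mult u w)),
           one = (ring_of_integers, \<lambda>P\<in>infinite_primes. 1)\<rparr>"

definition divisor_degree :: "'a::number_field odivisor \<Rightarrow> real" where
  "divisor_degree = (\<lambda>(I, u).
     - ln (ideal_norm I * (\<Prod>P\<in>infinite_primes. cmod (u P) ^ prime_degree P)))"

definition oDiv0 :: "'a::number_field odivisor monoid" where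
  "oDiv0 = oDiv \<lparr>carrier := {D \<in> carrier oDiv. divisor_degree D = 0}\<rparr>"

definition principal_divisor :: "'a::number_field \<Rightarrow> 'a odivisor" where
  "principal_divisor f = (principal_ideal (inverse f), to_FR f)"

definition principal_divisors :: "'a::number_field odivisor set" where
  "principal_divisors = principal_divisor ` {f. f \<noteq> 0}"

definition oPic0 :: "'a::number_field odivisor set monoid" where
  "oPic0 = oDiv0 Mod principal_divisors"

definition divisor_class :: "'a::number_field odivisor \<Rightarrow> 'a odivisor set" where
  "divisor_class D = principal_divisors #>\<^bsub>oDiv0\<^esub> D"

definition ideal_divisor :: "'a::number_field set \<Rightarrow> 'a odivisor" where
  "ideal_divisor I =
     (I, \<lambda>P\<in>infinite_primes. of_real (ideal_norm I powr (- 1 / real (field_degree TYPE('a)))))"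

definition reduced_divisors :: "'a::number_field odivisor set" where
  "reduced_divisors = {ideal_divisor I | I. fractional_ideal I \<and> minimal_in I 1}"

end

(*
  Let D = d(I) and D' = d(J) be reduced, with D - D' + (f) = (O_F, v). Then I = f J, so 1 and f are
  both minimal in I, and f = r v for a positive scalar r. If every |log v| is below log(4/3), then
  minimality of 1 and of f forces 3/4 <= r <= 4/3, so all conjugates of the element f - 1 of I have
  absolute value below (4/3)^2 - 1 = 7/9 < 1, and minimality of 1 gives f = 1. In the Pic-norm
  version f is first multiplied by a unit; for the injectivity, log(v/w) is bounded by log(4/3).

  The group of oriented divisors needs invertible fractional ideals. The ideal (1, x) is invertible
  because the coefficients of p / (X - x), for the primitive integer polynomial p of x, are integral;
  this is glued to finitely many generators by a partition of unity. That translates of reduced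
  divisors have degree 0 uses that F has exactly n complex embeddings, hence a primitive element.
*)
theory Submission
  imports Defs "Jordan_Normal_Form.Char_Poly" "HOL-Computational_Algebra.Field_as_Ring"
begin

section \<open>Algebraic integers\<close>

text \<open>The constant enters through (4/3)^2 = 16/9 < 2. The hypotheses do not bound log r; the
  two minimality conditions do, with the same bound as for log v. The distance of f from 1 is then
  controlled by |exp z - 1| <= exp |z| - 1, which treats the arguments of the conjugates together
  with their absolute values. The algebra is forced by the encoding. \<open>inv\<close> in
  \<open>oDiv\<close> expresses a difference of divisors only once the group laws hold. The
  \<open>card\<close> of an infinite quotient is 0, which would make \<open>ideal_norm\<close> and
  the coordinates of d(I) vanish, so O/dI must be shown finite. In place of an integral basis this
  uses O/pO for primes p: any n + 1 algebraic integers satisfy a primitive integer relation, so O/pO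
  has dimension at most n. The same finiteness makes fractional ideals finitely generated. The
  primitive element is found inside F itself, by deforming an element of maximal degree.\<close>

interpretation Z: Modules.module "\<lambda>(k::int) (x::'a::field_char_0). of_int k * x"
  by unfold_locales (auto simp: algebra_simps)

text \<open>An integral eigenvalue of an integer matrix: the generators form the eigenvector.\<close>

lemma algebraic_int_if_stabilizes:
  fixes \<gamma> :: "'a::field_char_0"
  assumes fin: "finite X" and x0: "x0 \<in> X" "x0 \<noteq> 0"
    and stable: "\<And>x. x \<in> X \<Longrightarrow> \<gamma> * x \<in> Z.span X"
  shows "algebraic_int \<gamma>"
proof -
  obtain xs where xs: "set xs = X" "distinct xs"
    using finite_distinct_list[OF fin] by blast
  define n where "n = length xs"
  have "\<forall>x\<in>X. \<exists>c. \<gamma> * x = (\<Sum>y\<in>X. of_int (c y) * y)"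
    using stable by (auto simp: Z.span_finite[OF fin])
  then obtain c where c: "\<And>x. x \<in> X \<Longrightarrow> \<gamma> * x = (\<Sum>y\<in>X. of_int (c x y) * y)"
    by metis
  have sum_X: "(\<Sum>y\<in>X. g y) = (\<Sum>j<n. g (xs ! j))" for g :: "'a \<Rightarrow> 'a"
    using xs bij_betw_nth[OF xs(2), of "{..<n}" X]
    by (intro sum.reindex_bij_betw[symmetric]) (auto simp: n_def)
  define A where "A = Matrix.mat n n (\<lambda>(i, j). c (xs ! i) (xs ! j))"
  define B where "B = map_mat (of_int :: int \<Rightarrow> 'a) A"
  define v where "v = Matrix.vec n (\<lambda>i. xs ! i)"
  have A: "A \<in> carrier_mat n n" and B: "B \<in> carrier_mat n n"
    by (auto simp: A_def B_def)
  have "B *\<^sub>v v = \<gamma> \<cdot>\<^sub>v v"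
  proof (rule eq_vecI)
    fix i assume "i < dim_vec (\<gamma> \<cdot>\<^sub>v v)"
    then have i: "i < n" by (simp add: v_def)
    then have "vec_index (B *\<^sub>v v) i = (\<Sum>j<n. of_int (c (xs ! i) (xs ! j)) * xs ! j)"
      using i by (auto simp: B_def A_def v_def scalar_prod_def atLeast0LessThan)
    also have "\<dots> = \<gamma> * xs ! i"
      using c[of "xs ! i"] i xs by (auto simp: sum_X n_def)
    finally show "vec_index (B *\<^sub>v v) i = vec_index (\<gamma> \<cdot>\<^sub>v v) i"
      using i by (simp add: v_def)
  qed (auto simp: B_def A_def v_def)
  moreover have "v \<noteq> 0\<^sub>v n"
  proof
    assume v0: "v = 0\<^sub>v n"
    obtain i where "i < n" "xs ! i = x0"
      using x0 xs by (auto simp: in_set_conv_nth n_def)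
    then have "vec_index v i = x0" by (simp add: v_def)
    then show False
      using v0 \<open>i < n\<close> x0 by simp
  qed
  moreover have "v \<in> carrier_vec n" by (simp add: v_def)
  ultimately have "eigenvalue B \<gamma>"
    using B unfolding eigenvalue_def eigenvector_def by auto
  then have "poly (char_poly B) \<gamma> = 0"
    by (simp add: eigenvalue_root_char_poly[OF B])
  then have "poly (map_poly of_int (char_poly A)) \<gamma> = 0"
    by (simp add: B_def of_int_hom.char_poly_hom[OF A])
  moreover have "lead_coeff (char_poly A) = 1"
    using degree_monic_char_poly[OF A] by simp
  ultimately show ?thesis
    unfolding algebraic_int_altdef_ipoly by blast
qed

lemma Z_span_stable:
  fixes \<gamma> :: "'a::field_char_0"
  assumes "\<And>x. x \<in> X \<Longrightarrow> \<gamma> * x \<in> Z.span X" "y \<in> Z.span X"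
  shows "\<gamma> * y \<in> Z.span X"
  using assms(2)
proof (induction rule: Z.span_induct_alt)
  case (step c x y)
  have "of_int c * (\<gamma> * x) + \<gamma> * y \<in> Z.span X"
    using step assms(1) by (intro Z.span_add Z.span_scale) auto
  then show ?case by (simp add: algebra_simps)
qed (simp add: Z.span_zero)

text \<open>Reduces a power of \<open>x\<close> to lower ones. The condition \<open>n > 0\<close>
  later puts 1 among the generators of the common module.\<close>

lemma algebraic_int_power_eq:
  fixes x :: "'a::field_char_0"
  assumes "algebraic_int x"
  obtains n c where "n > 0" "x ^ n = (\<Sum>i<n. of_int (c i) * x ^ i)"
proof -
  obtain p where p: "poly (map_poly of_int p) x = 0" "lead_coeff p = 1"
    using assms by (auto simp: algebraic_int_altdef_ipoly)
  define n where "n = degree p"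
  have eq: "(\<Sum>i\<le>n. of_int (coeff p i) * x ^ i) = 0"
    using p(1) by (simp add: poly_altdef degree_map_poly coeff_map_poly n_def)
  \<comment> \<open>In degree 0 a monic polynomial is the constant 1, which has no root.\<close>
  have "n > 0"
  proof (rule ccontr)
    assume "\<not> n > 0"
    then show False using eq p(2) by (simp add: n_def)
  qed
  moreover have "x ^ n = (\<Sum>i<n. of_int (- coeff p i) * x ^ i)"
  proof -
    have "(\<Sum>i<n. of_int (coeff p i) * x ^ i) + x ^ n = 0"
      using eq p(2) by (simp add: n_def lessThan_Suc_atMost[symmetric])
    then show ?thesis
      by (simp add: sum_negf eq_neg_iff_add_eq_0 add.commute)
  qed
  ultimately show ?thesis by (rule that)
qed

text \<open>The products \<open>x\<^sup>i y\<^sup>j\<close> of bounded degrees generate a module stable under \<open>x\<close> and \<open>y\<close>.\<close>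

lemma algebraic_int_common_module:
  fixes x y :: "'a::field_char_0"
  assumes "algebraic_int x" "algebraic_int y"
  obtains X where "finite X" "1 \<in> X" "\<And>z. z \<in> Z.span X \<Longrightarrow> x * z \<in> Z.span X"
    "\<And>z. z \<in> Z.span X \<Longrightarrow> y * z \<in> Z.span X"
proof -
  obtain m c where m: "m > 0" "x ^ m = (\<Sum>i<m. of_int (c i) * x ^ i)"
    using algebraic_int_power_eq[OF assms(1)] by blast
  obtain n d where n: "n > 0" "y ^ n = (\<Sum>j<n. of_int (d j) * y ^ j)"
    using algebraic_int_power_eq[OF assms(2)] by blast
  define X where "X = (\<lambda>(i, j). x ^ i * y ^ j) ` ({..<m} \<times> {..<n})"
  have mem: "x ^ i * y ^ j \<in> Z.span X" if "i < m" "j < n" for i j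
    using that by (intro Z.span_base) (auto simp: X_def)
  have memx: "x ^ m * y ^ j \<in> Z.span X" if "j < n" for j
  proof -
    have "x ^ m * y ^ j = (\<Sum>i<m. of_int (c i) * (x ^ i * y ^ j))"
      by (simp add: m(2) sum_distrib_right mult.assoc)
    then show ?thesis
      using mem that by (auto intro!: Z.span_sum Z.span_scale)
  qed
  have memy: "x ^ i * y ^ n \<in> Z.span X" if "i < m" for i
  proof -
    have "x ^ i * y ^ n = (\<Sum>j<n. of_int (d j) * (x ^ i * y ^ j))"
      by (simp add: n(2) sum_distrib_left mult_ac)
    then show ?thesis
      using mem that by (auto intro!: Z.span_sum Z.span_scale)
  qed
  have "x * z \<in> Z.span X" if "z \<in> X" for z
  proof -
    obtain i j where ij: "i < m" "j < n" "z = x ^ i * y ^ j"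
      using \<open>z \<in> X\<close> by (auto simp: X_def)
    have "x ^ Suc i * y ^ j \<in> Z.span X"
      using mem[of "Suc i" j] memx[of j] ij by (cases "Suc i = m") auto
    then show ?thesis using ij by (simp add: mult_ac)
  qed
  moreover have "y * z \<in> Z.span X" if "z \<in> X" for z
  proof -
    obtain i j where ij: "i < m" "j < n" "z = x ^ i * y ^ j"
      using \<open>z \<in> X\<close> by (auto simp: X_def)
    have "x ^ i * y ^ Suc j \<in> Z.span X"
      using mem[of i "Suc j"] memy[of i] ij by (cases "Suc j = n") auto
    then show ?thesis using ij by (simp add: mult_ac)
  qed
  moreover have "finite X" by (simp add: X_def)
  moreover have "1 \<in> X"
    using m(1) n(1) by (force simp: X_def)
  ultimately show ?thesis
    using that Z_span_stable by metis
qed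

lemma algebraic_int_add:
  fixes x y :: "'a::field_char_0"
  assumes "algebraic_int x" "algebraic_int y"
  shows "algebraic_int (x + y)"
proof -
  obtain X where X: "finite X" "1 \<in> X" "\<And>z. z \<in> Z.span X \<Longrightarrow> x * z \<in> Z.span X"
    "\<And>z. z \<in> Z.span X \<Longrightarrow> y * z \<in> Z.span X"
    using algebraic_int_common_module[OF assms] by blast
  show ?thesis
    by (rule algebraic_int_if_stabilizes[OF X(1,2)])
       (simp_all add: distrib_right Z.span_add X(3,4) Z.span_base)
qed

lemma algebraic_int_mult:
  fixes x y :: "'a::field_char_0"
  assumes "algebraic_int x" "algebraic_int y"
  shows "algebraic_int (x * y)"
proof -
  obtain X where X: "finite X" "1 \<in> X" "\<And>z. z \<in> Z.span X \<Longrightarrow> x * z \<in> Z.span X"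
    "\<And>z. z \<in> Z.span X \<Longrightarrow> y * z \<in> Z.span X"
    using algebraic_int_common_module[OF assms] by blast
  show ?thesis
    by (rule algebraic_int_if_stabilizes[OF X(1,2)])
       (simp_all add: mult.assoc X(3,4) Z.span_base)
qed

lemma algebraic_int_diff:
  fixes x y :: "'a::field_char_0"
  assumes "algebraic_int x" "algebraic_int y"
  shows "algebraic_int (x - y)"
  using algebraic_int_add[OF assms(1) algebraic_int_minus[OF assms(2)]] by simp

lemma algebraic_int_of_int [simp]: "algebraic_int (of_int k)"
  by (intro int_imp_algebraic_int) auto

lemma algebraic_int_of_nat [simp]: "algebraic_int (of_nat k)"
  using algebraic_int_of_int[of "int k"] by simp

lemma algebraic_int_1 [simp]: "algebraic_int 1"
  using algebraic_int_of_int[of 1] by simp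

lemma algebraic_int_sum:
  fixes f :: "'b \<Rightarrow> 'a::field_char_0"
  assumes "\<And>i. i \<in> S \<Longrightarrow> algebraic_int (f i)"
  shows "algebraic_int (sum f S)"
  using assms by (induction S rule: infinite_finite_induct) (auto intro: algebraic_int_add)

section \<open>Dividing an integer polynomial by a linear factor\<close>

text \<open>
  If \<open>\<theta>\<close> is a root of \<open>p\<close>, then \<open>horner_coeff p \<theta> k\<close> is the coefficient of index \<open>k - 1\<close> of
  \<open>p / (X - \<theta>)\<close>; it maps the module generated by \<open>1, \<theta>, \<dots>\<close>, up to degree \<open>degree p - 1\<close>, into
  itself.
\<close>

definition horner_coeff :: "int poly \<Rightarrow> 'a::field_char_0 \<Rightarrow> nat \<Rightarrow> 'a" where
  "horner_coeff p \<theta> k = (\<Sum>j\<in>{k..degree p}. of_int (coeff p j) * \<theta> ^ (j - k))"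

text \<open>Horner's recursion for synthetic division by \<open>X - \<theta>\<close>.\<close>

lemma horner_coeff_Suc:
  assumes "k \<le> degree p"
  shows "horner_coeff p \<theta> k = of_int (coeff p k) + \<theta> * horner_coeff p \<theta> (Suc k)"
proof -
  have "horner_coeff p \<theta> k
      = of_int (coeff p k) + (\<Sum>j\<in>{Suc k..degree p}. of_int (coeff p j) * \<theta> ^ (j - k))"
    using assms by (simp add: horner_coeff_def sum.atLeast_Suc_atMost)
  also have "(\<Sum>j\<in>{Suc k..degree p}. of_int (coeff p j) * \<theta> ^ (j - k))
      = \<theta> * horner_coeff p \<theta> (Suc k)"
    unfolding horner_coeff_def sum_distrib_left
    by (intro sum.cong) (auto simp: Suc_diff_Suc algebra_simps simp flip: power_Suc)
  finally show ?thesis .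
qed

text \<open>Index 0 belongs to the remainder of the division, so the value vanishes at a
  root.\<close>

lemma horner_coeff_0: "horner_coeff p \<theta> 0 = poly (map_poly of_int p) \<theta>"
  by (simp add: horner_coeff_def poly_altdef degree_map_poly coeff_map_poly atMost_atLeast0)

text \<open>In \<open>p(\<theta>) = 0\<close> the terms of index at least \<open>k\<close> are minus
  the terms below \<open>k\<close>; this trades high powers of \<open>\<theta>\<close> for low
  ones.\<close>

lemma horner_coeff_shift:
  assumes "poly (map_poly of_int p) \<theta> = 0" "k \<le> Suc (degree p)"
  shows "horner_coeff p \<theta> k * \<theta> ^ k = - (\<Sum>j<k. of_int (coeff p j) * \<theta> ^ j)"
  using assms(2)
proof (induction k)
  case 0
  then show ?case by (simp add: horner_coeff_0 assms(1))
next
  case (Suc k)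
  then have "horner_coeff p \<theta> k * \<theta> ^ k
      = of_int (coeff p k) * \<theta> ^ k + horner_coeff p \<theta> (Suc k) * \<theta> ^ Suc k"
    by (simp add: horner_coeff_Suc algebra_simps)
  moreover have "horner_coeff p \<theta> k * \<theta> ^ k = - (\<Sum>j<k. of_int (coeff p j) * \<theta> ^ j)"
    using Suc by simp
  ultimately show ?case
    by (simp only: sum.lessThan_Suc minus_add) (simp add: eq_diff_eq add.commute)
qed

lemma algebraic_int_horner_coeff:
  fixes \<theta> :: "'a::field_char_0"
  assumes root: "poly (map_poly of_int p) \<theta> = 0"
  shows "algebraic_int (horner_coeff p \<theta> k)"
\<comment> \<open>Outside the range from 1 to \<open>degree p\<close> the value is 0: it is
  \<open>p(\<theta>)\<close> at \<open>k = 0\<close> and an empty sum above the degree.\<close>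
proof (cases "k = 0 \<or> k > degree p")
  case True
  then show ?thesis
    by (auto simp: horner_coeff_0 root) (simp add: horner_coeff_def)
next
  case False
  define n where "n = degree p"
  have k: "0 < k" "k \<le> n" using False by (auto simp: n_def)
  define X where "X = (\<lambda>i. \<theta> ^ i) ` {..<n}"
  have mem: "\<theta> ^ i \<in> Z.span X" if "i < n" for i
    using that by (auto simp: X_def intro: Z.span_base)
  have "horner_coeff p \<theta> k * \<theta> ^ i \<in> Z.span X" if "i < n" for i
  \<comment> \<open>For \<open>i < k\<close> the exponents are at most \<open>n - k + i < n\<close>.
    For \<open>i \<ge> k\<close> they would overflow, so the complementary low terms are used, whose
    exponents \<open>j + (i - k)\<close> stay below \<open>i\<close>.\<close>
  proof (cases "i < k")
    case True
    have "horner_coeff p \<theta> k * \<theta> ^ i = (\<Sum>j\<in>{k..n}. of_int (coeff p j) * \<theta> ^ (j - k + i))"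
      by (simp add: horner_coeff_def sum_distrib_right mult.assoc n_def flip: power_add)
    also have "\<dots> \<in> Z.span X"
      using True by (intro Z.span_sum Z.span_scale mem) auto
    finally show ?thesis .
  next
    case False
    have "horner_coeff p \<theta> k * \<theta> ^ i = (horner_coeff p \<theta> k * \<theta> ^ k) * \<theta> ^ (i - k)"
      using False by (simp add: mult.assoc flip: power_add)
    also have "\<dots> = - (\<Sum>j<k. of_int (coeff p j) * \<theta> ^ (j + (i - k)))"
      using k by (subst horner_coeff_shift[OF root])
        (auto simp: n_def sum_distrib_right power_add mult.assoc)
    also have "\<dots> \<in> Z.span X"
      using False that by (intro Z.span_neg Z.span_sum Z.span_scale mem) auto
    finally show ?thesis .
  qed
  moreover have "1 \<in> X"
    unfolding X_def using k by (intro image_eqI[of _ _ 0]) auto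
  ultimately show ?thesis
    by (intro algebraic_int_if_stabilizes[of X 1]) (auto simp: X_def)
qed

text \<open>By the recursion, \<open>\<theta>\<close> times a coefficient is the preceding
  coefficient minus an integer.\<close>

lemma algebraic_int_mult_horner_coeff:
  fixes \<theta> :: "'a::field_char_0"
  assumes root: "poly (map_poly of_int p) \<theta> = 0"
  shows "algebraic_int (\<theta> * horner_coeff p \<theta> k)"
proof (cases "k = 0 \<or> k > degree p")
  case True
  then show ?thesis
    by (auto simp: horner_coeff_0 root) (simp add: horner_coeff_def)
next
  case False
  then obtain j where j: "k = Suc j" "j \<le> degree p" by (cases k) auto
  have "\<theta> * horner_coeff p \<theta> k = horner_coeff p \<theta> j - of_int (coeff p j)"
    using horner_coeff_Suc[OF j(2), of \<theta>] j(1) by simp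
  then show ?thesis
    using algebraic_int_horner_coeff[OF assms] by (simp add: algebraic_int_diff)
qed

lemma Gcd_int_linear_combination:
  fixes c :: "'b \<Rightarrow> int"
  assumes "finite S"
  obtains u where "(\<Sum>i\<in>S. u i * c i) = Gcd (c ` S)"
proof -
  have "\<exists>u. (\<Sum>i\<in>S. u i * c i) = Gcd (c ` S)"
    using assms
  proof (induction S)
    case (insert s S)
    then obtain u where u: "(\<Sum>i\<in>S. u i * c i) = Gcd (c ` S)" by blast
    obtain a b where ab: "a * c s + b * Gcd (c ` S) = gcd (c s) (Gcd (c ` S))"
      using bezout_int by blast
    have "(\<Sum>i\<in>insert s S. (if i = s then a else b * u i) * c i)
        = a * c s + (\<Sum>i\<in>S. (if i = s then a else b * u i) * c i)"
      using insert by simp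
    also have "(\<Sum>i\<in>S. (if i = s then a else b * u i) * c i) = (\<Sum>i\<in>S. b * (u i * c i))"
      using insert by (intro sum.cong) auto
    also have "\<dots> = b * Gcd (c ` S)"
      by (simp add: u flip: sum_distrib_left)
    finally show ?case using ab by auto
  qed auto
  then show ?thesis using that by blast
qed

text \<open>The top Horner coefficient is the leading coefficient of \<open>p\<close>, so its
  product with \<open>x\<close> is integral; multiplying by its sign makes the denominator
  positive.\<close>

lemma algebraic_denominator:
  fixes x :: "'a::field_char_0"
  assumes "algebraic x"
  obtains d :: nat where "d > 0" "algebraic_int (of_nat d * x)"
proof -
  obtain p where p: "p \<noteq> 0" "poly (map_poly of_int p) x = 0"
    using algebraicE'[OF assms] .
  have "algebraic_int (x * horner_coeff p x (degree p))"
    using algebraic_int_mult_horner_coeff p by blast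
  then have "algebraic_int (x * of_int (lead_coeff p))"
    by (simp add: horner_coeff_def)
  then have "algebraic_int (of_int (sgn (lead_coeff p)) * (x * of_int (lead_coeff p)))"
    by (intro algebraic_int_mult[OF algebraic_int_of_int])
  moreover have "of_int (sgn (lead_coeff p)) * (x * of_int (lead_coeff p))
      = of_nat (nat \<bar>lead_coeff p\<bar>) * x"
  proof -
    have "of_nat (nat \<bar>lead_coeff p\<bar>) = (of_int \<bar>lead_coeff p\<bar> :: 'a)" by simp
    also have "\<dots> = of_int (lead_coeff p) * of_int (sgn (lead_coeff p))"
      by (simp only: abs_sgn of_int_mult)
    finally show ?thesis by simp
  qed
  ultimately show ?thesis
    using p(1) that[of "nat \<bar>lead_coeff p\<bar>"] by simp
qed

text \<open>
  The ideal \<open>(1, \<theta>)\<close> is invertible: for a primitive \<open>p\<close> with root \<open>\<theta>\<close>, both \<open>b\<close> and \<open>\<theta> b\<close> are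
  integral for every coefficient \<open>b\<close> of \<open>p / (X - \<theta>)\<close>, and the coefficients of \<open>p\<close> are differences
  of such numbers.
\<close>

lemma algebraic_partition_of_unity:
  fixes \<theta> :: "'a::field_char_0"
  assumes "algebraic \<theta>"
  obtains s t where "algebraic_int s" "algebraic_int (\<theta> * s)" "algebraic_int t"
    "algebraic_int (\<theta> * t)" "s + \<theta> * t = 1"
proof -
  obtain q where q: "q \<noteq> 0" "poly (map_poly of_int q) \<theta> = 0"
    using algebraicE'[OF assms] .
  define p where "p = primitive_part q"
  have "coeff q i = content q * coeff p i" for i
    unfolding p_def coeff_smult[symmetric] by simp
  then have "map_poly of_int q = Polynomial.smult (of_int (content q) :: 'a) (map_poly of_int p)"
    by (intro poly_eqI) (simp add: coeff_map_poly)
  then have "poly (map_poly of_int q) \<theta> = of_int (content q) * poly (map_poly of_int p) \<theta>"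
    by simp
  then have p: "p \<noteq> 0" "poly (map_poly of_int p) \<theta> = 0"
    using q by (auto simp: p_def)
  have "Gcd (coeff p ` {..degree p}) = 1"
  proof -
    have "set (coeffs p) = coeff p ` {..degree p}"
      using p(1) by (auto simp: coeffs_def simp del: upt_Suc)
    then have "content p = Gcd (coeff p ` {..degree p})"
      by (simp add: content_def Gcd_fin_eq_Gcd Gcd_set_eq_fold)
    then show ?thesis using content_primitive_part[OF q(1)] by (simp add: p_def)
  qed
  then obtain u where u: "(\<Sum>k\<le>degree p. u k * coeff p k) = 1"
    using Gcd_int_linear_combination[of "{..degree p}" "coeff p"] by auto
  \<comment> \<open>With Bezout coefficients \<open>u\<close>, the identity
    \<open>\<Sum> u k * coeff p k = 1\<close> is split along the recursion, each coefficient of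
    \<open>p\<close> being a Horner coefficient minus \<open>\<theta>\<close> times the next
    one.\<close>
  define s where "s = (\<Sum>k\<le>degree p. of_int (u k) * horner_coeff p \<theta> k)"
  define t where "t = (\<Sum>k\<le>degree p. of_int (- u k) * horner_coeff p \<theta> (Suc k))"
  have "s + \<theta> * t
      = (\<Sum>k\<le>degree p. of_int (u k) * (horner_coeff p \<theta> k - \<theta> * horner_coeff p \<theta> (Suc k)))"
    unfolding s_def t_def sum_distrib_left sum.distrib[symmetric]
    by (intro sum.cong) (auto simp: algebra_simps)
  also have "\<dots> = (\<Sum>k\<le>degree p. of_int (u k * coeff p k))"
    by (intro sum.cong) (auto simp: horner_coeff_Suc)
  also have "\<dots> = 1"
    using u by (metis of_int_1 of_int_sum)
  finally have "s + \<theta> * t = 1" .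
  moreover have "algebraic_int s" "algebraic_int t"
    unfolding s_def t_def
    by (intro algebraic_int_sum algebraic_int_mult algebraic_int_horner_coeff p
        algebraic_int_of_int)+
  moreover have "\<theta> * s = (\<Sum>k\<le>degree p. of_int (u k) * (\<theta> * horner_coeff p \<theta> k))"
    "\<theta> * t = (\<Sum>k\<le>degree p. of_int (- u k) * (\<theta> * horner_coeff p \<theta> (Suc k)))"
    by (simp_all add: s_def t_def sum_distrib_left mult_ac)
  then have "algebraic_int (\<theta> * s)" "algebraic_int (\<theta> * t)"
    by (auto intro!: algebraic_int_sum algebraic_int_mult[OF algebraic_int_of_int]
        algebraic_int_mult[OF algebraic_int_minus] algebraic_int_mult_horner_coeff p)
  ultimately show ?thesis using that by blast
qed

section \<open>Number fields as rational vector spaces\<close>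

interpretation Q: vector_space "\<lambda>(q::rat) (x::'a::number_field). of_rat q * x"
  by unfold_locales (auto simp: algebra_simps of_rat_add of_rat_mult)

text \<open>The class axiom gives only a finite generating family, whereas the finite-dimensional
  locale asks for a fixed basis; extending the empty set provides one.\<close>

definition rat_basis :: "'a::number_field set" where
  "rat_basis = Q.extend_basis {}"

lemma rat_basis:
  "Q.independent (rat_basis :: 'a::number_field set)" "Q.span rat_basis = (UNIV :: 'a set)"
  using Q.independent_empty Q.independent_extend_basis Q.span_extend_basis
  by (auto simp: rat_basis_def)

lemma finite_rat_basis: "finite (rat_basis :: 'a::number_field set)"
proof -
  obtain B :: "'a set" where B: "finite B"
    "\<forall>x. \<exists>p q. x = (\<Sum>b\<in>B. of_int (p b) / of_int (q b) * b)"
    using finite_over_rat by blast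
  have "x \<in> Q.span B" for x
  proof -
    obtain p q where pq: "x = (\<Sum>b\<in>B. of_int (p b) / of_int (q b) * b)"
      using B(2) by blast
    also have "\<dots> = (\<Sum>b\<in>B. of_rat (of_int (p b) / of_int (q b)) * b)"
      by (simp add: of_rat_divide)
    also have "\<dots> \<in> Q.span B"
      by (intro Q.span_sum Q.span_scale Q.span_base)
    finally show ?thesis .
  qed
  then show ?thesis
    using Q.independent_span_bound[OF B(1) rat_basis(1)] by blast
qed

interpretation Q: finite_dimensional_vector_space
  "\<lambda>(q::rat) (x::'a::number_field). of_rat q * x" rat_basis
  by unfold_locales (use rat_basis finite_rat_basis in auto)

lemma independent_card_le_field_degree:
  assumes "Q.independent (B :: 'a::number_field set)"
  shows "finite B" "card B \<le> field_degree TYPE('a)"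
  using Q.finiteI_independent[OF assms] Q.independent_card_le_dim[OF subset_UNIV assms]
  by (simp_all add: field_degree_def del: Q.dim_UNIV)

lemma field_degree_pos: "field_degree TYPE('a::number_field) > 0"
  using independent_card_le_field_degree(2)[of "{1::'a}"] by simp

text \<open>Stated for indexed families because powers \<open>x ^ i\<close> may coincide; a repeated
  value is itself a relation, with coefficients 1 and -1.\<close>

lemma rational_relation:
  fixes f :: "'i \<Rightarrow> 'a::number_field"
  assumes S: "finite S" "card S > field_degree TYPE('a)"
  obtains u where "(\<Sum>i\<in>S. of_rat (u i) * f i) = 0" "\<exists>i\<in>S. u i \<noteq> 0"
proof (cases "inj_on f S")
  case True
  have "Q.dependent (f ` S)"
    using independent_card_le_field_degree(2)[of "f ` S"] S True by (auto simp: card_image)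
  then obtain u v where u: "v \<in> f ` S" "u v \<noteq> 0" "(\<Sum>v\<in>f ` S. of_rat (u v) * v) = 0"
    using Q.dependent_finite[of "f ` S"] S by auto
  then show ?thesis
    using True that[of "u \<circ> f"] by (auto simp: sum.reindex)
next
  case False
  then obtain i j where ij: "i \<in> S" "j \<in> S" "i \<noteq> j" "f i = f j"
    by (auto simp: inj_on_def)
  define u where "u k = (if k = i then 1 else 0) + (if k = j then -1 else (0::rat))" for k
  have "of_rat (u k) * f k = (if k = i then f k else 0) + (if k = j then - f k else 0)" for k
    by (auto simp: u_def)
  then have "(\<Sum>k\<in>S. of_rat (u k) * f k) = 0"
    using ij S by (simp add: sum.distrib)
  moreover have "u i \<noteq> 0" using ij by (simp add: u_def)
  ultimately show ?thesis using that[of u] ij by blast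
qed

lemma rational_poly_root:
  fixes x :: "'a::number_field"
  obtains p :: "rat poly" where "p \<noteq> 0" "degree p \<le> field_degree TYPE('a)"
    "poly (map_poly of_rat p) x = 0"
proof -
  define n where "n = field_degree TYPE('a)"
  obtain u where u: "(\<Sum>i\<in>{..n}. of_rat (u i) * x ^ i) = 0" "\<exists>i\<in>{..n}. u i \<noteq> 0"
    using rational_relation[of "{..n}" "\<lambda>i. x ^ i"] by (auto simp: n_def)
  define p where "p = (\<Sum>i\<le>n. monom (u i) i)"
  have coeff: "coeff p i = (if i \<le> n then u i else 0)" for i
    by (simp add: p_def coeff_sum)
  have "p \<noteq> 0"
    using u(2) coeff by (metis atMost_iff coeff_0)
  moreover have deg: "degree p \<le> n"
    by (rule degree_le) (simp add: coeff)
  moreover have "poly (map_poly of_rat p) x = 0"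
  proof -
    have "poly (map_poly of_rat p) x = (\<Sum>i\<le>n. of_rat (coeff p i) * x ^ i)"
      unfolding poly_altdef using deg
      by (intro sum.mono_neutral_cong_left) (auto simp: degree_map_poly coeff_map_poly coeff_eq_0)
    then show ?thesis using u(1) by (simp add: coeff)
  qed
  ultimately show ?thesis using that n_def by blast
qed

lemma algebraic_number_field [simp]: "algebraic (x :: 'a::number_field)"
proof -
  obtain p :: "rat poly" where p: "p \<noteq> 0" "poly (map_poly of_rat p) x = 0"
    using rational_poly_root[of x] by blast
  show ?thesis
    by (rule algebraicI'[of "map_poly of_rat p"]) (use p in \<open>auto simp: coeff_map_poly\<close>)
qed

lemma common_denominator:
  fixes u :: "'i \<Rightarrow> rat"
  assumes "finite S"
  obtains d :: int and c :: "'i \<Rightarrow> int" where "d > 0" "\<forall>i\<in>S. of_int (c i) = of_int d * u i"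
proof -
  have "\<exists>d>0. \<forall>i\<in>S. \<exists>c. of_int c = of_int d * u i"
    using assms
  proof (induction S)
    case (insert s S)
    then obtain d where d: "d > 0" "\<forall>i\<in>S. \<exists>c. of_int c = of_int d * u i" by blast
    obtain a b where ab: "b > 0" "u s = of_int a / of_int b"
      by (cases "u s" rule: Rat_cases) (auto simp: Fract_of_int_quotient)
    have "\<exists>c. of_int c = of_int (d * b) * u i" if "i \<in> insert s S" for i
    proof (cases "i = s")
      case True
      then show ?thesis using ab by (intro exI[of _ "d * a"]) simp
    next
      case False
      then have "i \<in> S" using that by simp
      from bspec[OF d(2) this] obtain c where "of_int c = of_int d * u i" ..
      then show ?thesis by (intro exI[of _ "c * b"]) simp
    qed
    then show ?case using d(1) ab(1) by (intro exI[of _ "d * b"]) simp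
  qed (simp add: exI[of _ 1])
  then obtain d where d: "d > 0" "\<forall>i\<in>S. \<exists>c. of_int c = of_int d * u i" by blast
  from bchoice[OF d(2)] obtain c where "\<forall>i\<in>S. of_int (c i) = of_int d * u i" ..
  then show ?thesis using that[of d c] d(1) by blast
qed

text \<open>Clearing denominators and dividing by the gcd keeps the relation nontrivial modulo every
  prime.\<close>

lemma primitive_relation:
  fixes f :: "'i \<Rightarrow> 'a::number_field"
  assumes S: "finite S" "card S > field_degree TYPE('a)"
  obtains c :: "'i \<Rightarrow> int" where "(\<Sum>i\<in>S. of_int (c i) * f i) = 0" "Gcd (c ` S) = 1"
proof -
  obtain u where u: "(\<Sum>i\<in>S. of_rat (u i) * f i) = 0" "\<exists>i\<in>S. u i \<noteq> 0"
    by (rule rational_relation[OF S])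
  obtain d c where dc: "d > 0" "\<forall>i\<in>S. of_int (c i) = of_int d * u i"
    by (rule common_denominator[OF S(1), of u])
  have "(\<Sum>i\<in>S. of_int (c i) * f i) = (\<Sum>i\<in>S. of_int d * (of_rat (u i) * f i))"
  proof (intro sum.cong refl)
    fix i assume "i \<in> S"
    then have "(of_rat (of_int (c i)) :: 'a) = of_rat (of_int d * u i)"
      using dc(2) by simp
    then show "of_int (c i) * f i = of_int d * (of_rat (u i) * f i)"
      by (simp add: of_rat_mult mult.assoc)
  qed
  then have rel: "(\<Sum>i\<in>S. of_int (c i) * f i) = 0"
    using u(1) by (simp flip: sum_distrib_left)
  have nz: "Gcd (c ` S) \<noteq> 0"
  proof -
    obtain i where "i \<in> S" "u i \<noteq> 0" using u(2) by blast
    then have "c i \<noteq> 0" using dc(1,2) by force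
    then show ?thesis using \<open>i \<in> S\<close> by auto
  qed
  define c' where "c' i = c i div Gcd (c ` S)" for i
  have c: "c i = Gcd (c ` S) * c' i" if "i \<in> S" for i
    using that by (simp add: c'_def)
  have "(\<Sum>i\<in>S. of_int (c i) * f i) = of_int (Gcd (c ` S)) * (\<Sum>i\<in>S. of_int (c' i) * f i)"
    unfolding sum_distrib_left
  proof (intro sum.cong refl)
    fix i assume "i \<in> S"
    from arg_cong[OF c[OF this], of "of_int :: int \<Rightarrow> 'a"]
    show "of_int (c i) * f i = of_int (Gcd (c ` S)) * (of_int (c' i) * f i)"
      by (simp only: of_int_mult mult.assoc)
  qed
  then have "(\<Sum>i\<in>S. of_int (c' i) * f i) = 0"
    using rel nz by simp
  moreover have "Gcd (c' ` S) = 1"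
  proof -
    have "c ` S = (*) (Gcd (c ` S)) ` (c' ` S)"
      unfolding image_image by (intro image_cong refl c)
    then have "Gcd ((*) (Gcd (c ` S)) ` (c' ` S)) = Gcd (c ` S)"
      by (rule arg_cong[OF sym])
    then have "Gcd (c ` S) * Gcd (c' ` S) = Gcd (c ` S)"
      by (simp only: Gcd_mult normalize_mult normalize_Gcd)
    then show ?thesis using nz by simp
  qed
  ultimately show ?thesis by (rule that)
qed

section \<open>Residues of the ring of integers\<close>

lemma ring_of_integers_iff [simp]: "x \<in> ring_of_integers \<longleftrightarrow> algebraic_int x"
  by (simp add: ring_of_integers_def)

text \<open>A maximal family that is independent modulo \<open>p\<close> generates \<open>O\<close> modulo \<open>p\<close>, and it has at most
  \<open>n\<close> members because a primitive relation over \<open>\<int>\<close> stays nontrivial modulo \<open>p\<close>.\<close>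

lemma finite_residues_prime:
  assumes p: "prime (p::nat)"
  obtains T :: "'a::number_field set" where "finite T"
    "\<And>x. algebraic_int x \<Longrightarrow> \<exists>t\<in>T. \<exists>y. algebraic_int y \<and> x = t + of_nat p * y"
proof -
  \<comment> \<open>Independence over Z/p of the residues in O/pO, phrased with integer
    coefficients.\<close>
  define indep where "indep B \<longleftrightarrow> finite B \<and> (\<forall>b\<in>B. algebraic_int b) \<and>
    (\<forall>c y. algebraic_int y \<longrightarrow> (\<Sum>b\<in>B. of_int (c b) * b) = of_nat p * y \<longrightarrow> (\<forall>b\<in>B. int p dvd c b))"
    for B :: "'a set"
  have bound: "card B < Suc (field_degree TYPE('a))" if "indep B" for B
  proof (rule ccontr)
    assume "\<not> card B < Suc (field_degree TYPE('a))"
    then have B: "finite B" "field_degree TYPE('a) < card B"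
      using \<open>indep B\<close> by (auto simp: indep_def)
    obtain c where c: "(\<Sum>b\<in>B. of_int (c b) * b) = 0" "Gcd (c ` B) = 1"
      by (rule primitive_relation[OF B, of "\<lambda>b. b"])
    then have "\<forall>b\<in>B. int p dvd c b"
      using \<open>indep B\<close> unfolding indep_def by (metis algebraic_int_0 mult_zero_right)
    then have "int p dvd Gcd (c ` B)" by (auto intro: Gcd_greatest)
    then show False using c(2) p by auto
  qed
  have "indep {}" by (simp add: indep_def)
  then obtain B where B: "indep B" "\<And>C. indep C \<Longrightarrow> card C \<le> card B"
    using ex_has_greatest_nat[of indep "{}" card] bound by (metis order_less_imp_le)
  then have fin: "finite B" and int: "\<And>b. b \<in> B \<Longrightarrow> algebraic_int b"
    by (auto simp: indep_def)
  define T where "T = (\<lambda>c. \<Sum>b\<in>B. of_int (c b) * b) ` (B \<rightarrow>\<^sub>E {0..<int p})"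
  have "finite T" by (simp add: T_def finite_PiE fin)
  moreover have "\<exists>t\<in>T. \<exists>y. algebraic_int y \<and> x = t + of_nat p * y" if x: "algebraic_int x" for x
  proof -
    have "\<exists>c y. algebraic_int y \<and> x = (\<Sum>b\<in>B. of_int (c b) * b) + of_nat p * y"
    \<comment> \<open>Inserting a member of \<open>B\<close> does not enlarge it, so maximality says
      something only about an \<open>x\<close> outside \<open>B\<close>.\<close>
    proof (cases "x \<in> B")
      case True
      have "(\<Sum>b\<in>B. of_int (if b = x then 1 else 0) * b) = (\<Sum>b\<in>B. if b = x then b else 0)"
        by (intro sum.cong) auto
      then have "x = (\<Sum>b\<in>B. of_int (if b = x then 1 else 0) * b) + of_nat p * 0"
        using fin True by simp
      then show ?thesis by (meson algebraic_int_0)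
    next
      case False
      have "\<not> indep (insert x B)"
        using B(2)[of "insert x B"] False fin by auto
      then obtain c y where cy: "algebraic_int y"
        "(\<Sum>b\<in>insert x B. of_int (c b) * b) = of_nat p * y" "\<not> (\<forall>b\<in>insert x B. int p dvd c b)"
        using fin int x by (auto simp: indep_def)
      have eq: "of_int (c x) * x + (\<Sum>b\<in>B. of_int (c b) * b) = of_nat p * y"
        using cy(2) fin False by simp
      have "\<not> int p dvd c x"
      proof
        assume "int p dvd c x"
        then obtain k where k: "c x = int p * k" by blast
        have "(\<Sum>b\<in>B. of_int (c b) * b) = of_nat p * (y - of_int k * x)"
          using eq by (simp add: k algebra_simps)
        moreover have "algebraic_int (y - of_int k * x)"
          by (intro algebraic_int_diff algebraic_int_mult cy x algebraic_int_of_int)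
        ultimately have "\<forall>b\<in>B. int p dvd c b" using B(1) by (auto simp: indep_def)
        then show False using cy(3) \<open>int p dvd c x\<close> by auto
      qed
      then have "coprime (int p) (c x)"
        using p by (intro prime_imp_coprime) auto
      \<comment> \<open>\<open>s\<close> inverts \<open>c x\<close> modulo \<open>p\<close>, so the
        relation can be solved for \<open>x\<close> modulo \<open>p\<close> times an algebraic
        integer.\<close>
      then obtain r s where rs: "r * int p + s * c x = 1"
        using bezout_int[of "int p" "c x"] by auto
      define A where "A = (\<Sum>b\<in>B. of_int (c b) * b)"
      have cx: "of_int (c x) * x = of_nat p * y - A"
        unfolding A_def using eq by (rule add_implies_diff)
      have "x = of_int (r * int p + s * c x) * x" by (simp only: rs) simp
      also have "\<dots> = of_nat p * (of_int r * x) + of_int s * (of_int (c x) * x)"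
        by (simp add: algebra_simps)
      also have "\<dots> = of_int (- s) * A + of_nat p * (of_int r * x + of_int s * y)"
        unfolding cx by (simp add: algebra_simps)
      also have "of_int (- s) * A = (\<Sum>b\<in>B. of_int (- s * c b) * b)"
        unfolding A_def sum_distrib_left by (simp only: of_int_mult mult.assoc)
      finally have "x = (\<Sum>b\<in>B. of_int (- s * c b) * b) + of_nat p * (of_int r * x + of_int s * y)" .
      moreover have "algebraic_int (of_int r * x + of_int s * y)"
        by (intro algebraic_int_add algebraic_int_mult algebraic_int_of_int x cy(1))
      ultimately show ?thesis by (intro exI conjI)
    qed
    then obtain c y where cy: "algebraic_int y" "x = (\<Sum>b\<in>B. of_int (c b) * b) + of_nat p * y"
      by blast
    \<comment> \<open>Only remainders modulo \<open>p\<close> are kept as coefficients, which leaves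
      finitely many combinations; the quotients join the multiple of \<open>p\<close>.\<close>
    define e where "e = (\<lambda>b\<in>B. c b mod int p)"
    define z where "z = (\<Sum>b\<in>B. of_int (c b div int p) * b)"
    have "(\<Sum>b\<in>B. of_int (c b) * b) = (\<Sum>b\<in>B. of_int (e b) * b + of_nat p * (of_int (c b div int p) * b))"
    proof (intro sum.cong refl)
      fix b assume "b \<in> B"
      have "(of_int (c b) :: 'a) = of_int (c b mod int p + int p * (c b div int p))"
        by simp
      also have "\<dots> = of_int (c b mod int p) + of_nat p * of_int (c b div int p)"
        by (simp only: of_int_add of_int_mult of_int_of_nat_eq)
      finally show "of_int (c b) * b = of_int (e b) * b + of_nat p * (of_int (c b div int p) * b)"
        using \<open>b \<in> B\<close> by (simp add: e_def algebra_simps)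
    qed
    also have "\<dots> = (\<Sum>b\<in>B. of_int (e b) * b) + of_nat p * z"
      by (simp add: sum.distrib z_def sum_distrib_left)
    finally have "x = (\<Sum>b\<in>B. of_int (e b) * b) + of_nat p * (z + y)"
      by (simp add: cy(2) algebra_simps)
    moreover have "(\<Sum>b\<in>B. of_int (e b) * b) \<in> T"
      unfolding T_def using p by (intro image_eqI[of _ _ e]) (auto simp: e_def prime_gt_0_nat)
    moreover have "algebraic_int (z + y)"
      unfolding z_def using cy(1) int
      by (auto intro!: algebraic_int_add algebraic_int_sum algebraic_int_mult)
    ultimately show ?thesis by blast
  qed
  ultimately show ?thesis using that by blast
qed

text \<open>Solving for a new element needs a prime modulus. A composite \<open>m = p * k\<close>
  follows by expanding the quotient of a division by \<open>k\<close> once more modulo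
  \<open>p\<close>.\<close>

lemma finite_residues:
  assumes "m > 0"
  obtains T :: "'a::number_field set" where "finite T"
    "\<And>x. algebraic_int x \<Longrightarrow> \<exists>t\<in>T. \<exists>y. algebraic_int y \<and> x = t + of_nat m * y"
proof -
  have "\<exists>T::'a set. finite T \<and>
      (\<forall>x. algebraic_int x \<longrightarrow> (\<exists>t\<in>T. \<exists>y. algebraic_int y \<and> x = t + of_nat m * y))"
    using assms
  proof (induction m rule: less_induct)
    case (less m)
    show ?case
    proof (cases "m = 1")
      case True
      then show ?thesis by (intro exI[of _ "{0}"]) auto
    next
      case False
      then obtain p k where pk: "prime p" "m = p * k"
        using prime_factor_nat[of m] by (auto elim: dvdE)
      then have "k < m" "k > 0" using less.prems prime_gt_1_nat[of p] by auto
      then obtain S :: "'a set" where S: "finite S"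
        "\<And>x. algebraic_int x \<Longrightarrow> \<exists>t\<in>S. \<exists>y. algebraic_int y \<and> x = t + of_nat k * y"
        using less.IH by blast
      obtain R :: "'a set" where R: "finite R"
        "\<And>x. algebraic_int x \<Longrightarrow> \<exists>t\<in>R. \<exists>y. algebraic_int y \<and> x = t + of_nat p * y"
        using finite_residues_prime[OF pk(1)] by blast
      define T where "T = (\<lambda>(s, r). s + of_nat k * r) ` (S \<times> R)"
      have "\<exists>t\<in>T. \<exists>y. algebraic_int y \<and> x = t + of_nat m * y" if x: "algebraic_int x" for x
      proof -
        obtain s y where sy: "s \<in> S" "algebraic_int y" "x = s + of_nat k * y"
          using S(2)[OF x] by blast
        obtain r z where rz: "r \<in> R" "algebraic_int z" "y = r + of_nat p * z"
          using R(2)[OF sy(2)] by blast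
        have "x = (s + of_nat k * r) + of_nat m * z"
          unfolding sy(3) rz(3) pk(2) by (simp add: algebra_simps)
        moreover have "s + of_nat k * r \<in> T" using sy(1) rz(1) by (auto simp: T_def)
        ultimately show ?thesis using rz(2) by blast
      qed
      moreover have "finite T" by (simp add: T_def S R)
      ultimately show ?thesis by blast
    qed
  qed
  then show ?thesis using that by blast
qed

section \<open>Fractional ideals\<close>

lemma fractional_idealD:
  assumes "fractional_ideal I"
  shows fractional_ideal_0: "0 \<in> I"
    and fractional_ideal_add: "\<And>x y. x \<in> I \<Longrightarrow> y \<in> I \<Longrightarrow> x + y \<in> I"
    and fractional_ideal_mult: "\<And>a x. algebraic_int a \<Longrightarrow> x \<in> I \<Longrightarrow> a * x \<in> I"
  using assms by (auto simp: fractional_ideal_def)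

lemma fractional_idealI:
  assumes "0 \<in> I" "a \<in> I" "a \<noteq> 0"
    and "\<And>x y. x \<in> I \<Longrightarrow> y \<in> I \<Longrightarrow> x + y \<in> I"
    and "\<And>c x. algebraic_int c \<Longrightarrow> x \<in> I \<Longrightarrow> c * x \<in> I"
    and d: "d \<noteq> 0" "algebraic_int d" "\<And>x. x \<in> I \<Longrightarrow> algebraic_int (d * x)"
  shows "fractional_ideal I"
proof -
  have "I \<noteq> {0}" using assms(2,3) by blast
  moreover have "\<exists>d\<in>ring_of_integers. d \<noteq> 0 \<and> (\<forall>x\<in>I. d * x \<in> ring_of_integers)"
    using d by (intro bexI[of _ d]) simp_all
  ultimately show ?thesis
    unfolding fractional_ideal_def using assms(1,4,5) by simp
qed

lemma fractional_ideal_nonzero: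
  assumes "fractional_ideal I"
  obtains a where "a \<in> I" "a \<noteq> 0"
  using assms by (auto simp: fractional_ideal_def)

lemma fractional_ideal_diff:
  assumes "fractional_ideal I" "x \<in> I" "y \<in> I"
  shows "x - y \<in> I"
proof -
  have "x + (-1) * y \<in> I"
    using assms by (intro fractional_ideal_add fractional_ideal_mult) auto
  then show ?thesis by simp
qed

text \<open>A denominator \<open>d\<close> in O becomes a natural number \<open>m\<close> with
  \<open>m / d\<close> integral, since \<open>m * x\<close> is the product of \<open>m / d\<close>
  and \<open>d * x\<close>.\<close>

lemma fractional_ideal_denominator:
  assumes "fractional_ideal I"
  obtains d :: nat where "d > 0" "\<And>x. x \<in> I \<Longrightarrow> algebraic_int (of_nat d * x)"
proof -
  have "\<exists>d\<in>ring_of_integers. d \<noteq> 0 \<and> (\<forall>x\<in>I. d * x \<in> ring_of_integers)"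
    using assms by (simp only: fractional_ideal_def)
  then obtain d where d: "algebraic_int d" "d \<noteq> 0" "\<forall>x\<in>I. algebraic_int (d * x)"
    by auto
  obtain m :: nat where m: "m > 0" "algebraic_int (of_nat m * inverse d)"
    using algebraic_denominator[OF algebraic_number_field] by blast
  have "algebraic_int (of_nat m * x)" if "x \<in> I" for x
  proof -
    have "of_nat m * inverse d * (d * x) = of_nat m * x" using d(2) by simp
    then show ?thesis using algebraic_int_mult[OF m(2) bspec[OF d(3) that]] by (simp only:)
  qed
  then show ?thesis using that m(1) by blast
qed

text \<open>For a nonzero \<open>a\<close> in \<open>I\<close>, take \<open>m\<close> with
  \<open>m / (d * a)\<close> integral. Congruence modulo \<open>m\<close> is then finer than
  congruence modulo \<open>d I\<close>, which transfers finiteness to O/dI.\<close>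

lemma fractional_ideal_contains_multiples:
  assumes I: "fractional_ideal I" and "d \<noteq> 0"
  obtains m :: nat where "m > 0" "\<And>y. algebraic_int y \<Longrightarrow> of_nat m * y \<in> (*) d ` I"
proof -
  obtain a where a: "a \<in> I" "a \<noteq> 0" using fractional_ideal_nonzero[OF I] .
  obtain m :: nat where m: "m > 0" "algebraic_int (of_nat m * inverse (d * a))"
    using algebraic_denominator[OF algebraic_number_field] by blast
  have "of_nat m * y \<in> (*) d ` I" if "algebraic_int y" for y
  proof -
    have "(of_nat m * inverse (d * a) * y) * a \<in> I"
      by (rule fractional_ideal_mult[OF I algebraic_int_mult[OF m(2) that] a(1)])
    moreover have "of_nat m * y = d * ((of_nat m * inverse (d * a) * y) * a)"
      using a assms(2) by (simp add: field_simps)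
    ultimately show ?thesis by blast
  qed
  then show ?thesis using that m(1) by blast
qed

text \<open>One element of \<open>I\<close> is chosen for each residue of \<open>d I\<close> modulo
  \<open>m\<close>. Two elements with the same residue differ by an integral multiple of
  \<open>b = m / d\<close>, hence the short form: one chosen element or 0, plus one
  multiple.\<close>

lemma fractional_ideal_finitely_generated:
  assumes I: "fractional_ideal (I :: 'a::number_field set)"
  obtains S where "finite S" "S \<noteq> {}" "S \<subseteq> I - {0}"
    "\<forall>x\<in>I. \<exists>a\<in>insert 0 S. \<exists>b\<in>S. \<exists>z. algebraic_int z \<and> x = a + z * b"
proof -
  obtain d :: nat where d: "d > 0" "\<And>x. x \<in> I \<Longrightarrow> algebraic_int (of_nat d * x)"
    using fractional_ideal_denominator[OF I] by blast
  obtain m :: nat where m: "m > 0" "\<And>y. algebraic_int y \<Longrightarrow> of_nat m * y \<in> (*) (of_nat d) ` I"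
    using fractional_ideal_contains_multiples[OF I, of "of_nat d"] d by auto
  obtain T :: "'a set" where T: "finite T"
    "\<And>x. algebraic_int x \<Longrightarrow> \<exists>t\<in>T. \<exists>y. algebraic_int y \<and> x = t + of_nat m * y"
    using finite_residues[OF m(1)] by blast
  define rep where
    "rep t x \<longleftrightarrow> x \<in> I \<and> (\<exists>y. algebraic_int y \<and> of_nat d * x = t + of_nat m * y)" for t x
  define g where "g t = (SOME x. rep t x)" for t
  define b :: 'a where "b = of_nat m / of_nat d"
  \<comment> \<open>The choice \<open>g t\<close> is arbitrary for residues that \<open>I\<close>
    does not meet, so these are left out. Removing 0 allows later division by the
    generators.\<close>
  define S where "S = insert b (g ` {t \<in> T. \<exists>x. rep t x} - {0})"
  have "b \<in> I" using m(2)[of 1] d(1) by (auto simp: b_def field_simps)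
  have gI: "g t \<in> I" if "rep t x" for t x
  proof -
    have "rep t (g t)" unfolding g_def using that by (rule someI)
    then show ?thesis by (simp add: rep_def)
  qed
  have "b \<noteq> 0" using m d by (simp add: b_def)
  have gen: "\<forall>x\<in>I. \<exists>a\<in>insert 0 S. \<exists>b\<in>S. \<exists>z. algebraic_int z \<and> x = a + z * b"
  proof
    fix x assume x: "x \<in> I"
    obtain t y where t: "t \<in> T" "algebraic_int y" "of_nat d * x = t + of_nat m * y"
      using T(2)[OF d(2)[OF x]] by blast
    then have "rep t x" using x by (auto simp: rep_def)
    then have "rep t (g t)" unfolding g_def by (rule someI)
    then obtain y' where y': "algebraic_int y'" "of_nat d * g t = t + of_nat m * y'"
      by (auto simp: rep_def)
    have "of_nat d * x = of_nat d * g t + of_nat m * (y - y')"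
      unfolding t(3) y'(2) by (simp add: algebra_simps)
    moreover have "of_nat m * (y - y') = of_nat d * ((y - y') * b)"
      using d(1) by (simp add: b_def)
    ultimately have "of_nat d * x = of_nat d * (g t + (y - y') * b)"
      by (simp only: distrib_left)
    then have "x = g t + (y - y') * b" using d(1) by simp
    moreover have "g t \<in> insert 0 S" using t \<open>rep t x\<close> by (auto simp: S_def)
    moreover have "algebraic_int (y - y')" using t y' by (simp add: algebraic_int_diff)
    moreover have "b \<in> S" by (simp add: S_def)
    ultimately show "\<exists>a\<in>insert 0 S. \<exists>b\<in>S. \<exists>z. algebraic_int z \<and> x = a + z * b"
      by blast
  qed
  have "finite S" "S \<noteq> {}" using T(1) by (auto simp: S_def)
  moreover have "S \<subseteq> I - {0}" using \<open>b \<in> I\<close> \<open>b \<noteq> 0\<close> gI by (auto simp: S_def)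
  ultimately show ?thesis using gen by (rule that)
qed

text \<open>The integrality condition puts each \<open>w a / a\<close> into the inverse of the ideal
  generated by \<open>S\<close>. When \<open>x\<close> is added, the weight at \<open>a\<close> is
  split by \<open>1 = s a + x / a * t a\<close>: the first share stays at \<open>a\<close>, the
  second moves to \<open>x\<close>.\<close>

lemma partition_of_unity:
  fixes S :: "'a::number_field set"
  assumes "finite S" "S \<noteq> {}" "0 \<notin> S"
  obtains w where "(\<Sum>a\<in>S. w a) = 1"
    "\<forall>a\<in>S. \<forall>b\<in>S. algebraic_int (w a * b / a)"
proof -
  have "\<exists>w. (\<Sum>a\<in>S. w a) = 1 \<and> (\<forall>a\<in>S. \<forall>b\<in>S. algebraic_int (w a * b / a))"
    using assms
  proof (induction S rule: finite_ne_induct)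
    case (singleton x)
    then show ?case by (intro exI[of _ "\<lambda>_. 1"]) auto
  next
    case (insert x F)
    then obtain w where w: "(\<Sum>a\<in>F. w a) = 1" "\<And>a b. a \<in> F \<Longrightarrow> b \<in> F \<Longrightarrow> algebraic_int (w a * b / a)"
      by auto
    have "\<forall>a. \<exists>s t. algebraic_int s \<and> algebraic_int (x / a * s) \<and> algebraic_int t \<and>
        algebraic_int (x / a * t) \<and> s + x / a * t = 1"
      by (meson algebraic_number_field algebraic_partition_of_unity)
    then obtain s t where st: "\<And>a. algebraic_int (s a)" "\<And>a. algebraic_int (x / a * s a)"
      "\<And>a. algebraic_int (t a)" "\<And>a. algebraic_int (x / a * t a)" "\<And>a. s a + x / a * t a = 1"
      by metis
    define w' where "w' a = (if a = x then \<Sum>a\<in>F. w a * (x / a * t a) else w a * s a)" for a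
    have nz: "x \<noteq> 0" "\<And>a. a \<in> F \<Longrightarrow> a \<noteq> 0" using insert.prems by auto
    have wint: "algebraic_int (w a)" if "a \<in> F" for a
      using w(2)[OF that that] nz that by simp
    have "(\<Sum>a\<in>F. w' a) = (\<Sum>a\<in>F. w a * s a)"
      using insert.hyps by (intro sum.cong) (auto simp: w'_def)
    then have "(\<Sum>a\<in>insert x F. w' a) = (\<Sum>a\<in>F. w a * (x / a * t a)) + (\<Sum>a\<in>F. w a * s a)"
      using insert.hyps by (simp add: w'_def)
    also have "\<dots> = (\<Sum>a\<in>F. w a * (s a + x / a * t a))"
      by (simp add: sum.distrib[symmetric] algebra_simps)
    also have "\<dots> = 1" by (simp only: st(5) mult_1_right w(1))
    finally have "(\<Sum>a\<in>insert x F. w' a) = 1" .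
    moreover have "algebraic_int (w' a * b / a)" if ab: "a \<in> insert x F" "b \<in> insert x F" for a b
    proof (cases "a = x")
      case [simp]: True
      show ?thesis
      proof (cases "b = x")
        case [simp]: True
        have "w' a * b / a = (\<Sum>a\<in>F. w a * (x / a * t a))"
          using nz by (simp add: w'_def)
        also have "algebraic_int \<dots>"
          by (intro algebraic_int_sum algebraic_int_mult[OF wint st(4)])
        finally show ?thesis .
      next
        case False
        then have "b \<in> F" using ab by auto
        have "w' a * b / a = (\<Sum>a\<in>F. (w a * b / a) * t a)"
          using nz by (auto simp: w'_def sum_distrib_right sum_divide_distrib intro!: sum.cong)
        also have "algebraic_int \<dots>"
          using w(2) \<open>b \<in> F\<close> st(3) by (intro algebraic_int_sum algebraic_int_mult)
        finally show ?thesis .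
      qed
    next
      case False
      then have a: "a \<in> F" using ab by auto
      show ?thesis
      proof (cases "b = x")
        case True
        then have "w' a * b / a = w a * (x / a * s a)" using False by (simp add: w'_def)
        then show ?thesis using wint[OF a] st(2) by (simp only:) (rule algebraic_int_mult)
      next
        case b: False
        then have "w' a * b / a = (w a * b / a) * s a" using False by (simp add: w'_def)
        moreover have "b \<in> F" using b ab by auto
        ultimately show ?thesis using w(2) a st(1) by (simp only:) (intro algebraic_int_mult)
      qed
    qed
    ultimately show ?case by blast
  qed
  then obtain w where "(\<Sum>a\<in>S. w a) = 1" "\<forall>a\<in>S. \<forall>b\<in>S. algebraic_int (w a * b / a)"
    by (elim exE conjE)
  then show ?thesis by (rule that)
qed

section \<open>Inverses, principal ideals and positivity of the norm\<close>

definition ideal_inverse :: "'a::number_field set \<Rightarrow> 'a set" where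
  "ideal_inverse I = {x. \<forall>y\<in>I. algebraic_int (x * y)}"

text \<open>The roles are exchanged: a denominator of \<open>I\<close> is a nonzero member of the
  inverse, and a nonzero \<open>a\<close> in \<open>I\<close>, made integral by \<open>d\<close>, is
  a denominator of the inverse.\<close>

lemma fractional_ideal_inverse:
  assumes I: "fractional_ideal (I :: 'a::number_field set)"
  shows "fractional_ideal (ideal_inverse I)"
proof -
  obtain d :: nat where d: "d > 0" "\<And>x. x \<in> I \<Longrightarrow> algebraic_int (of_nat d * x)"
    using fractional_ideal_denominator[OF I] by blast
  obtain a where a: "a \<in> I" "a \<noteq> 0" using fractional_ideal_nonzero[OF I] .
  have mult: "algebraic_int (c * x * y)" if "algebraic_int c" "algebraic_int (x * y)" for c x y :: 'a
    using algebraic_int_mult[OF that] by (simp add: mult.assoc)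
  show ?thesis
  proof (rule fractional_idealI)
    show "of_nat d \<in> ideal_inverse I" using d by (simp add: ideal_inverse_def)
    show "of_nat d * a \<noteq> 0" using d(1) a(2) by simp
    show "algebraic_int (of_nat d * a * x)" if "x \<in> ideal_inverse I" for x
      using that a mult[of "of_nat d" a x] by (simp add: ideal_inverse_def mult.commute)
  qed (use d a mult in \<open>auto simp: ideal_inverse_def algebraic_int_add distrib_right\<close>)
qed

lemma fractional_ideal_ring_of_integers: "fractional_ideal (ring_of_integers :: 'a::number_field set)"
  by (rule fractional_idealI[of _ 1 1]) (auto simp: algebraic_int_add algebraic_int_mult)

lemma principal_ideal_iff: "f \<noteq> 0 \<Longrightarrow> x \<in> principal_ideal f \<longleftrightarrow> algebraic_int (x / f)"
  by (auto simp: principal_ideal_def image_iff intro!: bexI[of _ "x / f"])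

lemma fractional_ideal_principal:
  assumes f: "f \<noteq> (0 :: 'a::number_field)"
  shows "fractional_ideal (principal_ideal f)"
proof -
  obtain m :: nat where m: "m > 0" "algebraic_int (of_nat m * f)"
    using algebraic_denominator[OF algebraic_number_field] by blast
  have "algebraic_int (of_nat m * x)" if "algebraic_int (x / f)" for x
    using algebraic_int_mult[OF m(2) that] f by simp
  moreover have "algebraic_int (c * x / f)" if "algebraic_int c" "algebraic_int (x / f)" for c x
    using algebraic_int_mult[OF that] by simp
  ultimately show ?thesis
    using f m(1)
    by (intro fractional_idealI[of _ f "of_nat m"])
       (auto simp: principal_ideal_iff add_divide_distrib algebraic_int_add)
qed

text \<open>Amounts to finiteness of the quotient, because \<open>card\<close> is 0 on infinite
  sets; every class modulo \<open>d I\<close> contains one of finitely many residues modulo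
  \<open>m\<close>.\<close>

lemma ideal_norm_pos:
  assumes I: "fractional_ideal (I :: 'a::number_field set)"
  shows "ideal_norm I > 0"
proof -
  let ?P = "\<lambda>d::nat. d > 0 \<and> (\<forall>x\<in>I. of_nat d * x \<in> (ring_of_integers :: 'a set))"
  define d where "d = (LEAST d. ?P d)"
  obtain d0 :: nat where "d0 > 0" "\<And>x. x \<in> I \<Longrightarrow> algebraic_int (of_nat d0 * x)"
    using fractional_ideal_denominator[OF I] by blast
  then have "?P d0" by simp
  then have "?P d" unfolding d_def by (rule LeastI)
  then have d: "d > 0" by blast
  define R where
    "R = {(x::'a, y). x \<in> ring_of_integers \<and> y \<in> ring_of_integers \<and> x - y \<in> (*) (of_nat d) ` I}"
  obtain m :: nat where m: "m > 0" "\<And>y. algebraic_int y \<Longrightarrow> of_nat m * y \<in> (*) (of_nat d) ` I"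
    using fractional_ideal_contains_multiples[OF I, of "of_nat d"] d by auto
  have dI: "u - v \<in> (*) (of_nat d) ` I" if "u \<in> (*) (of_nat d) ` I" "v \<in> (*) (of_nat d) ` I" for u v
  proof -
    obtain x y where "x \<in> I" "u = of_nat d * x" "y \<in> I" "v = of_nat d * y"
      using \<open>u \<in> _\<close> \<open>v \<in> _\<close> by blast
    then have "x - y \<in> I" "u - v = of_nat d * (x - y)"
      using fractional_ideal_diff[OF I] by (simp_all add: right_diff_distrib)
    then show ?thesis by blast
  qed
  have dI0: "0 \<in> (*) (of_nat d) ` I"
    using fractional_ideal_0[OF I] by force
  have "equiv ring_of_integers R"
  proof (rule equivI)
    show "R \<subseteq> ring_of_integers \<times> ring_of_integers" by (auto simp: R_def)
    show "refl_on ring_of_integers R" using dI0 by (auto simp: R_def refl_on_def)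
    show "sym R"
    proof (rule symI)
      fix x y assume "(x, y) \<in> R"
      then show "(y, x) \<in> R" using dI[OF dI0, of "x - y"] by (auto simp: R_def)
    qed
    show "trans R"
    proof (rule transI)
      fix x y z assume xyz: "(x, y) \<in> R" "(y, z) \<in> R"
      then have "(x - y) - (0 - (y - z)) \<in> (*) (of_nat d) ` I"
        by (intro dI[OF _ dI[OF dI0]]) (auto simp: R_def)
      then show "(x, z) \<in> R" using xyz by (simp add: R_def)
    qed
  qed
  obtain T :: "'a set" where T: "finite T"
    "\<And>x. algebraic_int x \<Longrightarrow> \<exists>t\<in>T. \<exists>y. algebraic_int y \<and> x = t + of_nat m * y"
    using finite_residues[OF m(1)] by blast
  have "ring_of_integers // R \<subseteq> (\<lambda>t. R `` {t}) ` T"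
  proof
    fix X assume "X \<in> ring_of_integers // R"
    then obtain x where x: "algebraic_int x" "X = R `` {x}" by (auto elim: quotientE)
    obtain t y where t: "t \<in> T" "algebraic_int y" "x = t + of_nat m * y" using T(2)[OF x(1)] by blast
    \<comment> \<open>Members of \<open>T\<close> need not be integral, but the one used here is a
      difference of two algebraic integers.\<close>
    then have "algebraic_int t"
      using algebraic_int_diff[OF x(1), of "of_nat m * y"] by (simp add: algebraic_int_mult)
    then have "(x, t) \<in> R" using x t m(2) by (simp add: R_def)
    then show "X \<in> (\<lambda>t. R `` {t}) ` T"
      using equiv_class_eq[OF \<open>equiv ring_of_integers R\<close>] t x by auto
  qed
  then have "finite (ring_of_integers // R)" using T(1) finite_surj by blast
  moreover have "R `` {0} \<in> ring_of_integers // R" by (intro quotientI) simp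
  ultimately have "card (ring_of_integers // R) > 0" by (auto simp: card_gt_0_iff)
  moreover have "ideal_norm I = real (card (ring_of_integers // R)) / real d ^ field_degree TYPE('a)"
    by (simp add: ideal_norm_def Let_def R_def d_def)
  ultimately show ?thesis using d by simp
qed

section \<open>Products of ideals and invertibility\<close>

lemma ideal_mult_add:
  assumes "x \<in> ideal_mult I J" "y \<in> ideal_mult I J"
  shows "x + y \<in> ideal_mult I J"
proof -
  obtain k a b where x: "x = (\<Sum>i<(k::nat). a i * b i)" "\<forall>i<k. a i \<in> I" "\<forall>i<k. b i \<in> J"
    using assms(1) by (auto simp: ideal_mult_def)
  obtain l c d where y: "y = (\<Sum>i<(l::nat). c i * d i)" "\<forall>i<l. c i \<in> I" "\<forall>i<l. d i \<in> J"
    using assms(2) by (auto simp: ideal_mult_def)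
  define a' where "a' i = (if i < k then a i else c (i - k))" for i
  define b' where "b' i = (if i < k then b i else d (i - k))" for i
  have "(\<Sum>i<k + l. a' i * b' i) = (\<Sum>i<k. a' i * b' i) + (\<Sum>i<l. a' (k + i) * b' (k + i))"
    by (induction l) (simp_all add: add.assoc)
  also have "\<dots> = x + y" by (simp add: a'_def b'_def x y)
  finally have "x + y = (\<Sum>i<k + l. a' i * b' i)" by simp
  moreover have "\<forall>i<k + l. a' i \<in> I" "\<forall>i<k + l. b' i \<in> J"
    using x y by (auto simp: a'_def b'_def)
  ultimately show ?thesis unfolding ideal_mult_def by blast
qed

lemma ideal_mult_0 [simp]: "0 \<in> ideal_mult I J"
  unfolding ideal_mult_def by (rule CollectI) (intro exI[of _ "0::nat"], simp)

lemma ideal_mult_prod: "a \<in> I \<Longrightarrow> b \<in> J \<Longrightarrow> a * b \<in> ideal_mult I J"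
  unfolding ideal_mult_def
  by (rule CollectI) (intro exI[of _ "1::nat"] exI[of _ "\<lambda>_. a"] exI[of _ "\<lambda>_. b"], simp)

lemma ideal_mult_sum: "(\<And>i. i \<in> S \<Longrightarrow> f i \<in> ideal_mult I J) \<Longrightarrow> sum f S \<in> ideal_mult I J"
  by (induction S rule: infinite_finite_induct) (auto intro: ideal_mult_add)

lemma ideal_mult_induct [consumes 1, case_names zero add prod]:
  assumes "x \<in> ideal_mult I J" "P 0" "\<And>x y. P x \<Longrightarrow> P y \<Longrightarrow> P (x + y)"
    "\<And>a b. a \<in> I \<Longrightarrow> b \<in> J \<Longrightarrow> P (a * b)"
  shows "P x"
proof -
  obtain k a b where x: "x = (\<Sum>i<(k::nat). a i * b i)" "\<forall>i<k. a i \<in> I" "\<forall>i<k. b i \<in> J"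
    using assms(1) by (auto simp: ideal_mult_def)
  have "P (\<Sum>i<j. a i * b i)" if "j \<le> k" for j
    using that
  proof (induction j)
    case (Suc j)
    then have "P (\<Sum>i<j. a i * b i)" "P (a j * b j)" using x assms(4) by auto
    then show ?case using assms(3) by simp
  qed (simp add: assms(2))
  then show ?thesis using x by blast
qed

lemma ideal_mult_commute: "ideal_mult I J = ideal_mult J I"
proof -
  have "x \<in> ideal_mult J I" if "x \<in> ideal_mult I J" for x and I J :: "'a set"
    using that
  proof (induction rule: ideal_mult_induct)
    case (prod a b)
    then show ?case by (subst mult.commute) (rule ideal_mult_prod)
  qed (auto intro: ideal_mult_add)
  then show ?thesis by blast
qed

lemma ideal_mult_assoc: "ideal_mult (ideal_mult I J) K = ideal_mult I (ideal_mult J K)"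
proof -
  have sub: "x \<in> ideal_mult I (ideal_mult J K)" if "x \<in> ideal_mult (ideal_mult I J) K"
    for x and I J K :: "'a set"
    using that
  proof (induction rule: ideal_mult_induct)
    case (prod y c)
    from prod(1) show ?case
    proof (induction rule: ideal_mult_induct)
      case (prod a b)
      then show ?case using \<open>c \<in> K\<close> by (simp add: mult.assoc ideal_mult_prod)
    qed (auto simp: distrib_right intro: ideal_mult_add)
  qed (auto intro: ideal_mult_add)
  \<comment> \<open>By commutativity this is the first inclusion with the three factors in reverse
    order.\<close>
  have "x \<in> ideal_mult (ideal_mult I J) K" if "x \<in> ideal_mult I (ideal_mult J K)" for x
    using sub[of x K J I] that by (metis ideal_mult_commute)
  then show ?thesis using sub by blast
qed

lemma fractional_ideal_ideal_mult:
  assumes I: "fractional_ideal I" and J: "fractional_ideal J"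
  shows "fractional_ideal (ideal_mult I J)"
proof -
  obtain d :: nat where d: "d > 0" "\<And>x. x \<in> I \<Longrightarrow> algebraic_int (of_nat d * x)"
    using fractional_ideal_denominator[OF I] by blast
  obtain e :: nat where e: "e > 0" "\<And>x. x \<in> J \<Longrightarrow> algebraic_int (of_nat e * x)"
    using fractional_ideal_denominator[OF J] by blast
  obtain a b where ab: "a \<in> I" "a \<noteq> 0" "b \<in> J" "b \<noteq> 0"
    using fractional_ideal_nonzero I J by metis
  show ?thesis
  proof (rule fractional_idealI)
    show "a * b \<in> ideal_mult I J" "a * b \<noteq> 0" using ab by (auto intro: ideal_mult_prod)
    show "c * x \<in> ideal_mult I J" if "algebraic_int c" "x \<in> ideal_mult I J" for c x
      using that(2)
    proof (induction rule: ideal_mult_induct)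
      case (prod a b)
      then show ?case
        using ideal_mult_prod[OF fractional_ideal_mult[OF I that(1)]] by (simp add: mult.assoc)
    qed (auto simp: distrib_left intro: ideal_mult_add)
    show "algebraic_int (of_nat (d * e) * x)" if "x \<in> ideal_mult I J" for x
      using that
    proof (induction rule: ideal_mult_induct)
      case (prod a b)
      then show ?case
        using algebraic_int_mult[OF d(2) e(2), of a b] by (simp add: mult_ac)
    qed (auto simp: distrib_left algebraic_int_add)
  qed (use d(1) e(1) in \<open>auto intro: ideal_mult_add algebraic_int_mult\<close>)
qed

lemma ideal_mult_principal:
  assumes I: "fractional_ideal I"
  shows "ideal_mult I (principal_ideal f) = (*) f ` I"
proof (intro subset_antisym subsetI)
  fix x assume "x \<in> ideal_mult I (principal_ideal f)"
  then show "x \<in> (*) f ` I"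
  proof (induction rule: ideal_mult_induct)
    case zero
    then show ?case using fractional_ideal_0[OF I] by force
  next
    case (add x y)
    then show ?case
      using fractional_ideal_add[OF I] by (auto simp: image_iff simp flip: distrib_left)
  next
    case (prod a b)
    then obtain c where c: "algebraic_int c" "b = f * c" by (auto simp: principal_ideal_def)
    then have "a * b = f * (c * a)" by (simp add: mult_ac)
    then show ?case using fractional_ideal_mult[OF I c(1) prod(1)] by blast
  qed
next
  fix x assume "x \<in> (*) f ` I"
  then obtain a where a: "a \<in> I" "x = a * (f * 1)" by (auto simp: mult_ac)
  then show "x \<in> ideal_mult I (principal_ideal f)"
    unfolding a(2) principal_ideal_def by (intro ideal_mult_prod imageI) simp_all
qed

lemma ideal_mult_ring_of_integers:
  assumes "fractional_ideal I"
  shows "ideal_mult I ring_of_integers = I"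
  using ideal_mult_principal[OF assms, of 1] by (simp add: principal_ideal_def)

text \<open>With a partition of unity \<open>w\<close> for generators \<open>a\<close> of \<open>I\<close>, the inverse contains every \<open>w a / a\<close>.\<close>

lemma ideal_mult_inverse:
  assumes I: "fractional_ideal I"
  shows "ideal_mult I (ideal_inverse I) = ring_of_integers"
proof (intro subset_antisym subsetI)
  fix x assume "x \<in> ideal_mult I (ideal_inverse I)"
  then show "x \<in> ring_of_integers"
    by (induction rule: ideal_mult_induct)
       (auto simp: algebraic_int_add ideal_inverse_def mult.commute)
next
  fix x :: 'a assume x: "x \<in> ring_of_integers"
  obtain S where S: "finite S" "S \<noteq> {}" "S \<subseteq> I - {0}"
    "\<forall>x\<in>I. \<exists>a\<in>insert 0 S. \<exists>b\<in>S. \<exists>z. algebraic_int z \<and> x = a + z * b"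
    by (rule fractional_ideal_finitely_generated[OF I])
  obtain w where w: "(\<Sum>a\<in>S. w a) = 1" "\<forall>a\<in>S. \<forall>b\<in>S. algebraic_int (w a * b / a)"
    by (rule partition_of_unity[OF S(1,2)]) (use S(3) in auto)
  have inv: "w a / a \<in> ideal_inverse I" if a: "a \<in> S" for a
    unfolding ideal_inverse_def
  proof (intro CollectI ballI)
    fix y assume "y \<in> I"
    then obtain u b z where y: "u \<in> insert 0 S" "b \<in> S" "algebraic_int z" "y = u + z * b"
      using bspec[OF S(4) \<open>y \<in> I\<close>] by blast
    have "algebraic_int (w a * u / a)" using bspec[OF w(2) a] y(1) by auto
    moreover have "algebraic_int (z * (w a * b / a))"
      using w(2) a y(2) by (intro algebraic_int_mult[OF y(3)]) simp
    ultimately have "algebraic_int (w a * u / a + z * (w a * b / a))"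
      by (rule algebraic_int_add)
    then show "algebraic_int (w a / a * y)"
      by (simp add: y(4) algebra_simps add_divide_distrib)
  qed
  have "x = (\<Sum>a\<in>S. (x * a) * (w a / a))"
  proof -
    have "(\<Sum>a\<in>S. (x * a) * (w a / a)) = (\<Sum>a\<in>S. x * w a)"
      using S(3) by (intro sum.cong) auto
    also have "\<dots> = x" by (simp add: w(1) flip: sum_distrib_left)
    finally show ?thesis by simp
  qed
  also have "\<dots> \<in> ideal_mult I (ideal_inverse I)"
    using x S(3) inv I by (intro ideal_mult_sum ideal_mult_prod fractional_ideal_mult) auto
  finally show "x \<in> ideal_mult I (ideal_inverse I)" .
qed

section \<open>Infinite primes\<close>

lemma embeddingsD:
  assumes "\<sigma> \<in> embeddings"
  shows embedding_1: "\<sigma> 1 = 1"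
    and embedding_add: "\<sigma> (x + y) = \<sigma> x + \<sigma> y"
    and embedding_mult: "\<sigma> (x * y) = \<sigma> x * \<sigma> y"
  using assms by (auto simp: embeddings_def)

lemma embedding_0: "\<sigma> \<in> embeddings \<Longrightarrow> \<sigma> 0 = 0"
  using embedding_add[of \<sigma> 0 0] by simp

lemma embedding_diff: "\<sigma> \<in> embeddings \<Longrightarrow> \<sigma> (x - y) = \<sigma> x - \<sigma> y"
  using embedding_add[of \<sigma> "x - y" y] by simp

lemma embedding_inverse:
  assumes "\<sigma> \<in> embeddings"
  shows "\<sigma> (inverse x) = inverse (\<sigma> x)"
proof (cases "x = 0")
  case False
  then have "\<sigma> x * \<sigma> (inverse x) = 1"
    using embedding_mult[OF assms, of x "inverse x"] embedding_1[OF assms] by simp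
  then show ?thesis by (simp add: inverse_unique)
qed (simp add: embedding_0[OF assms])

lemma embedding_eq_0_iff:
  assumes "\<sigma> \<in> embeddings"
  shows "\<sigma> x = 0 \<longleftrightarrow> x = 0"
proof
  assume "\<sigma> x = 0"
  then show "x = 0"
    using embedding_mult[OF assms, of x "inverse x"] embedding_1[OF assms] by (cases "x = 0") auto
qed (simp add: embedding_0[OF assms])

lemma embedding_cnj: "\<sigma> \<in> embeddings \<Longrightarrow> cnj \<circ> \<sigma> \<in> embeddings"
  by (simp add: embeddings_def)

abbreviation conjugation_rel :: "(('a::number_field \<Rightarrow> complex) \<times> ('a \<Rightarrow> complex)) set" where
  "conjugation_rel \<equiv> {(\<sigma>, \<tau>). \<sigma> \<in> embeddings \<and> (\<tau> = \<sigma> \<or> \<tau> = cnj \<circ> \<sigma>)}"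

lemma cnj_cnj_comp [simp]: "cnj \<circ> (cnj \<circ> \<sigma>) = \<sigma>"
  by (auto simp: fun_eq_iff)

lemma equiv_conjugation_rel: "equiv embeddings conjugation_rel"
  by (rule equivI) (auto simp: refl_on_def sym_def trans_def embedding_cnj)

lemma infinite_prime_eq:
  assumes P: "P \<in> infinite_primes"
  shows "prime_embedding P \<in> embeddings" "P = {prime_embedding P, cnj \<circ> prime_embedding P}"
proof -
  obtain \<sigma> where \<sigma>: "\<sigma> \<in> embeddings" "P = conjugation_rel `` {\<sigma>}"
    using P by (auto simp: infinite_primes_def elim: quotientE)
  then have P_eq: "P = {\<sigma>, cnj \<circ> \<sigma>}" by auto
  have "prime_embedding P \<in> P"
    unfolding prime_embedding_def by (rule someI[of _ \<sigma>]) (simp add: P_eq)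
  then show "prime_embedding P \<in> embeddings" "P = {prime_embedding P, cnj \<circ> prime_embedding P}"
    using \<sigma>(1) embedding_cnj[OF \<sigma>(1)] unfolding P_eq by auto
qed

lemma real_prime_iff:
  "real_prime P \<longleftrightarrow> cnj \<circ> prime_embedding P = prime_embedding P"
  by (auto simp: real_prime_def fun_eq_iff Reals_cnj_iff image_subset_iff)

text \<open>A class shrinks to one element exactly when conjugation fixes the embedding.\<close>

lemma prime_degree_eq_card: "P \<in> infinite_primes \<Longrightarrow> prime_degree P = card P"
  by (subst infinite_prime_eq(2), assumption)
     (auto simp: prime_degree_def real_prime_iff card_insert_if)

text \<open>The classes partition the embeddings, and each degree is the size of its class.\<close>

lemma sum_prime_degree:
  assumes "finite (embeddings :: ('a::number_field \<Rightarrow> complex) set)"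
  shows "(\<Sum>P\<in>(infinite_primes :: ('a \<Rightarrow> complex) set set). prime_degree P)
    = card (embeddings :: ('a \<Rightarrow> complex) set)"
proof -
  let ?E = "embeddings :: ('a \<Rightarrow> complex) set"
  have "card (\<Union> (?E // conjugation_rel)) = (\<Sum>P\<in>?E // conjugation_rel. card P)"
    using assms quotient_disj[OF equiv_conjugation_rel]
      finite_equiv_class[OF assms] equiv_type[OF equiv_conjugation_rel]
    by (intro card_Union_disjoint) (auto simp: pairwise_def disjnt_def)
  then have "card ?E = (\<Sum>P\<in>(infinite_primes :: ('a \<Rightarrow> complex) set set). card P)"
    by (simp add: Union_quotient[OF equiv_conjugation_rel] infinite_primes_def)
  also have "\<dots> = (\<Sum>P\<in>(infinite_primes :: ('a \<Rightarrow> complex) set set). prime_degree P)"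
    by (intro sum.cong) (auto simp: prime_degree_eq_card)
  finally show ?thesis by simp
qed

lemma finite_infinite_primes:
  "finite (embeddings :: ('a::number_field \<Rightarrow> complex) set) \<Longrightarrow>
    finite (infinite_primes :: ('a \<Rightarrow> complex) set set)"
  unfolding infinite_primes_def
  using equiv_type[OF equiv_conjugation_rel] by (intro finite_quotient) auto

section \<open>The group of oriented divisors\<close>

lemma completion_mult: "x \<in> completion P \<Longrightarrow> y \<in> completion P \<Longrightarrow> x * y \<in> completion P"
  by (auto simp: completion_def)

lemma completion_inverse: "x \<in> completion P \<Longrightarrow> inverse x \<in> completion P"
  by (auto simp: completion_def)

lemma of_real_in_completion [simp]: "of_real r \<in> completion P"
  by (simp add: completion_def)

lemma prime_embedding_in_completion [simp]: "prime_embedding P x \<in> completion P"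
  by (auto simp: completion_def real_prime_def)

lemma FR_units_iff:
  "u \<in> FR_units \<longleftrightarrow>
    u \<in> extensional infinite_primes \<and> (\<forall>P\<in>infinite_primes. u P \<in> completion P \<and> u P \<noteq> 0)"
  by (auto simp: FR_units_def PiE_iff)

lemma FR_eqI:
  assumes "u \<in> extensional infinite_primes" "w \<in> extensional infinite_primes"
    "\<And>P. P \<in> infinite_primes \<Longrightarrow> u P = w P"
  shows "u = w"
  using assms by (rule extensionalityI)

lemma FR_mult_closed: "u \<in> FR_units \<Longrightarrow> w \<in> FR_units \<Longrightarrow> FR_mult u w \<in> FR_units"
  by (auto simp: FR_units_iff FR_mult_def completion_mult)

lemma FR_mult_1: "u \<in> FR_units \<Longrightarrow> FR_mult (\<lambda>P\<in>infinite_primes. 1) u = u"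
  by (rule FR_eqI) (auto simp: FR_units_iff FR_mult_def)

lemma FR_mult_inverse_exists:
  assumes "u \<in> FR_units"
  shows "\<exists>w\<in>FR_units. FR_mult w u = (\<lambda>P\<in>infinite_primes. 1)"
  using assms
  by (intro bexI[of _ "\<lambda>P\<in>infinite_primes. inverse (u P)"])
     (auto simp: FR_units_iff FR_mult_def completion_inverse intro!: restrict_ext)

lemma one_FR_units: "(\<lambda>P\<in>infinite_primes. 1) \<in> FR_units"
  using of_real_in_completion[of 1] by (auto simp: FR_units_iff)

lemma to_FR_units: "f \<noteq> 0 \<Longrightarrow> to_FR f \<in> FR_units"
  by (auto simp: FR_units_iff to_FR_def embedding_eq_0_iff infinite_prime_eq)

lemma oDiv_simps:
  "(I, u) \<otimes>\<^bsub>oDiv\<^esub> (J, w) = (ideal_mult I J, FR_mult u w)"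
  "\<one>\<^bsub>oDiv\<^esub> = (ring_of_integers, \<lambda>P\<in>infinite_primes. 1)"
  "D \<in> carrier oDiv \<longleftrightarrow> fractional_ideal (fst D) \<and> snd D \<in> FR_units"
  by (auto simp: oDiv_def mem_Times_iff)

text \<open>Gives \<open>inv\<close>, and with it D - D', its meaning. The ideal component of an
  inverse is where invertibility of fractional ideals is used.\<close>

lemma comm_group_oDiv: "comm_group (oDiv :: 'a::number_field odivisor monoid)"
proof (rule comm_groupI)
  fix D E F :: "'a odivisor"
  obtain I u J v K w where DEF: "D = (I, u)" "E = (J, v)" "F = (K, w)"
    by (metis surj_pair)
  show "D \<otimes>\<^bsub>oDiv\<^esub> E \<in> carrier oDiv" if "D \<in> carrier oDiv" "E \<in> carrier oDiv"
    using that by (simp add: DEF oDiv_simps fractional_ideal_ideal_mult FR_mult_closed)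
  show "D \<otimes>\<^bsub>oDiv\<^esub> E \<otimes>\<^bsub>oDiv\<^esub> F = D \<otimes>\<^bsub>oDiv\<^esub> (E \<otimes>\<^bsub>oDiv\<^esub> F)"
    by (auto simp: DEF oDiv_simps ideal_mult_assoc FR_mult_def mult.assoc intro!: restrict_ext)
  show "D \<otimes>\<^bsub>oDiv\<^esub> E = E \<otimes>\<^bsub>oDiv\<^esub> D"
    by (auto simp: DEF oDiv_simps FR_mult_def mult.commute intro!: restrict_ext ideal_mult_commute)
  show "\<one>\<^bsub>oDiv\<^esub> \<otimes>\<^bsub>oDiv\<^esub> D = D" if "D \<in> carrier oDiv"
    using that ideal_mult_ring_of_integers[of I] ideal_mult_commute[of I ring_of_integers]
    by (simp add: DEF oDiv_simps FR_mult_1)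
  show "\<exists>E\<in>carrier oDiv. E \<otimes>\<^bsub>oDiv\<^esub> D = \<one>\<^bsub>oDiv\<^esub>" if "D \<in> carrier oDiv"
  proof -
    have I: "fractional_ideal I" and u: "u \<in> FR_units" using that by (auto simp: DEF oDiv_simps)
    obtain w where w: "w \<in> FR_units" "FR_mult w u = (\<lambda>P\<in>infinite_primes. 1)"
      using FR_mult_inverse_exists[OF u] by blast
    have "ideal_mult (ideal_inverse I) I = ring_of_integers"
      using ideal_mult_inverse[OF I] ideal_mult_commute[of I "ideal_inverse I"] by simp
    then show ?thesis
      using w fractional_ideal_inverse[OF I]
      by (intro bexI[of _ "(ideal_inverse I, w)"]) (simp_all add: DEF oDiv_simps)
  qed
qed (simp add: oDiv_simps fractional_ideal_ring_of_integers one_FR_units)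

lemma principal_divisor_in_carrier: "f \<noteq> 0 \<Longrightarrow> principal_divisor f \<in> carrier oDiv"
  by (simp add: principal_divisor_def oDiv_simps fractional_ideal_principal to_FR_units)

lemma ideal_divisor_in_carrier:
  assumes "fractional_ideal I"
  shows "ideal_divisor I \<in> carrier oDiv"
proof -
  have "(\<lambda>P\<in>infinite_primes. complex_of_real r) \<in> FR_units" if "r \<noteq> 0" for r
    using that by (auto simp: FR_units_iff)
  moreover have "ideal_norm I powr (- 1 / real (field_degree TYPE('a))) \<noteq> 0"
    using ideal_norm_pos[OF assms] by simp
  ultimately show ?thesis
    using assms unfolding oDiv_simps ideal_divisor_def fst_conv snd_conv by blast
qed

section \<open>Nearby reduced divisors\<close>

text \<open>Both sides are exponential series without the constant term, compared term by
  term.\<close>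

lemma norm_exp_minus_1_le: "norm (exp z - 1) \<le> exp (norm z) - 1" for z :: complex
proof -
  let ?f = "\<lambda>n. inverse (fact (Suc n)) *\<^sub>R z ^ Suc n"
  have norm_f: "norm (?f n) = inverse (fact (Suc n)) *\<^sub>R norm z ^ Suc n" for n
    by (simp add: norm_mult norm_power)
  have "summable (\<lambda>n. inverse (fact (Suc n)) *\<^sub>R norm z ^ Suc n)"
    by (rule iffD2[OF summable_Suc_iff[of "\<lambda>n. norm z ^ n /\<^sub>R fact n"] summable_exp_generic])
  then have "norm (\<Sum>n. ?f n) \<le> (\<Sum>n. norm (?f n))"
    by (intro summable_norm) (simp only: norm_f)
  then show ?thesis
    using exp_first_term[of z] exp_first_term[of "norm z"] by (simp only: norm_f) simp
qed

text \<open>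
  The sizes of \<open>1\<close> and \<open>f\<close>, both minimal in \<open>I\<close>, force \<open>3/4 \<le> r \<le> 4/3\<close>; then every conjugate of
  \<open>f - 1\<close> has absolute value below \<open>(4/3)\<^sup>2 - 1 < 1\<close>.
\<close>

lemma minimal_multiplier_eq_1:
  fixes f :: "'a::number_field" and y :: "('a \<Rightarrow> complex) set \<Rightarrow> complex"
  assumes I: "fractional_ideal I" and min: "minimal_in I 1" "minimal_in J 1"
    and f: "f \<noteq> 0" and IJ: "I = (*) f ` J" and r: "r > 0"
    and emb: "\<And>P. P \<in> infinite_primes \<Longrightarrow> prime_embedding P f = of_real r * exp (y P)"
    and y: "\<And>P. P \<in> infinite_primes \<Longrightarrow> cmod (y P) < ln (4 / 3)"
  shows "f = 1"
proof -
  have one: "1 \<in> I" "1 \<in> J" using min by (auto simp: minimal_in_def)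
  have minI: "g = 0" if "g \<in> I" "\<And>P. P \<in> infinite_primes \<Longrightarrow> cmod (prime_embedding P g) < 1" for g
    using min(1) that by (auto simp: minimal_in_def embedding_1 infinite_prime_eq)
  have minJ: "g = 0" if "g \<in> J" "\<And>P. P \<in> infinite_primes \<Longrightarrow> cmod (prime_embedding P g) < 1" for g
    using min(2) that by (auto simp: minimal_in_def embedding_1 infinite_prime_eq)
  have emb_norm: "r * (3 / 4) < cmod (prime_embedding P f)" "cmod (prime_embedding P f) < r * (4 / 3)"
    if P: "P \<in> infinite_primes" for P
  proof -
    have "\<bar>Re (y P)\<bar> < ln (4 / 3)"
      using y[OF P] abs_Re_le_cmod[of "y P"] by linarith
    then have "- ln (4 / 3) < Re (y P)" "Re (y P) < ln (4 / 3)" by linarith+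
    then have "exp (- ln (4 / 3)) < exp (Re (y P))" "exp (Re (y P)) < exp (ln (4 / 3))"
      by (simp_all only: exp_less_cancel_iff)
    moreover have "exp (- ln (4 / 3)) = (3 / 4 :: real)" "exp (ln (4 / 3)) = (4 / 3 :: real)"
      by (simp_all add: exp_minus)
    ultimately have "3 / 4 < exp (Re (y P))" "exp (Re (y P)) < 4 / 3"
      by linarith+
    then show "r * (3 / 4) < cmod (prime_embedding P f)" "cmod (prime_embedding P f) < r * (4 / 3)"
      using r by (simp_all add: emb[OF P] norm_mult)
  qed
  \<comment> \<open>Otherwise all conjugates of \<open>f\<close> exceed 1 in absolute value, and
    \<open>1 / f\<close>, which is in \<open>J\<close> because 1 is in \<open>f J\<close>,
    contradicts minimality of 1 in \<open>J\<close>.\<close>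
  have "r \<le> 4 / 3"
  proof (rule ccontr)
    assume "\<not> r \<le> 4 / 3"
    then have r': "r * (3 / 4) > 1" by simp
    obtain g where g: "g \<in> J" "1 = f * g" using one(1) IJ by auto
    have "cmod (prime_embedding P g) < 1" if P: "P \<in> infinite_primes" for P
    proof -
      have "g = inverse f" using g(2) by (metis inverse_unique)
      then have "cmod (prime_embedding P g) = inverse (cmod (prime_embedding P f))"
        using embedding_inverse[OF infinite_prime_eq(1)[OF P]] by (simp add: norm_inverse)
      also have "\<dots> < 1"
        using emb_norm(1)[OF P] r' by (intro inverse_less_1_iff[THEN iffD2]) linarith
      finally show ?thesis .
    qed
    then have "g = 0" using minJ g(1) by blast
    then show False using g(2) by simp
  qed
  \<comment> \<open>Here \<open>f\<close> itself, in \<open>I\<close> because 1 is in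
    \<open>J\<close>, would contradict minimality of 1 in \<open>I\<close>.\<close>
  moreover have "3 / 4 \<le> r"
  proof (rule ccontr)
    assume "\<not> 3 / 4 \<le> r"
    then have r': "r * (4 / 3) < 1" by simp
    have "f \<in> I" using one(2) IJ by force
    moreover have "cmod (prime_embedding P f) < 1" if P: "P \<in> infinite_primes" for P
      using emb_norm(2)[OF P] r' by linarith
    ultimately have "f = 0" using minI by blast
    then show False using f by simp
  qed
  ultimately have "exp (ln r) \<le> exp (ln (4 / 3))" "exp (- ln (4 / 3)) \<le> exp (ln r)"
    using r by (simp_all add: exp_minus)
  then have ln_r: "\<bar>ln r\<bar> \<le> ln (4 / 3)" unfolding exp_le_cancel_iff by linarith
  have "f - 1 \<in> I" using one IJ I by (intro fractional_ideal_diff) force+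
  moreover have "cmod (prime_embedding P (f - 1)) < 1" if P: "P \<in> infinite_primes" for P
  proof -
    note \<sigma> = infinite_prime_eq(1)[OF P]
    have "prime_embedding P (f - 1) = of_real (exp (ln r)) * exp (y P) - 1"
      using r by (simp add: embedding_diff[OF \<sigma>] embedding_1[OF \<sigma>] emb[OF P])
    \<comment> \<open>Scalar and exponential merge into one exponent of modulus below
      \<open>2 * ln (4 / 3)\<close>, which gives the bound \<open>16 / 9 - 1\<close>.\<close>
    also have "\<dots> = exp (of_real (ln r) + y P) - 1"
      by (simp add: exp_add exp_of_real)
    also have "cmod \<dots> \<le> exp (cmod (of_real (ln r) + y P)) - 1"
      by (rule norm_exp_minus_1_le)
    also have "cmod (of_real (ln r) + y P) < ln (4 / 3) + ln (4 / 3)"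
      using norm_triangle_ineq[of "of_real (ln r)" "y P"] ln_r y[OF P] by simp
    then have "exp (cmod (of_real (ln r) + y P)) - 1 < exp (ln (4 / 3) + ln (4 / 3)) - 1"
      by simp
    also have "\<dots> < 1" unfolding exp_add by simp
    finally show ?thesis .
  qed
  ultimately have "f - 1 = 0" using minI by blast
  then show ?thesis by simp
qed

section \<open>Primitive elements\<close>

text \<open>The target field is left open so that one rational polynomial can be evaluated both in
  the number field and at complex numbers.\<close>

definition rat_eval :: "rat poly \<Rightarrow> 'a::field_char_0 \<Rightarrow> 'a" where
  "rat_eval p x = poly (map_poly of_rat p) x"

lemma rat_eval_0 [simp]: "rat_eval 0 x = 0"
  by (simp add: rat_eval_def)

lemma rat_eval_pCons [simp]: "rat_eval (pCons a p) x = of_rat a + x * rat_eval p x"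
  by (simp add: rat_eval_def of_rat_hom.map_poly_pCons_hom)

lemma rat_eval_1 [simp]: "rat_eval 1 x = 1"
  by (simp add: rat_eval_def)

lemma rat_eval_add: "rat_eval (p + q) x = rat_eval p x + rat_eval q x"
proof -
  have "map_poly of_rat (p + q) = map_poly of_rat p + (map_poly of_rat q :: 'a poly)"
    by (intro poly_eqI) (simp add: coeff_map_poly of_rat_add)
  then show ?thesis by (simp add: rat_eval_def)
qed

lemma rat_eval_smult: "rat_eval (Polynomial.smult a p) x = of_rat a * rat_eval p x"
proof -
  have "map_poly of_rat (Polynomial.smult a p) = Polynomial.smult (of_rat a :: 'a) (map_poly of_rat p)"
    by (intro poly_eqI) (simp add: coeff_map_poly of_rat_mult)
  then show ?thesis by (simp add: rat_eval_def)
qed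

lemma rat_eval_diff: "rat_eval (p - q) x = rat_eval p x - rat_eval q x"
  using rat_eval_add[of "p - q" q x] by simp

lemma rat_eval_mult: "rat_eval (p * q) x = rat_eval p x * rat_eval q x"
  by (induction p) (simp_all add: rat_eval_add rat_eval_smult algebra_simps)

lemma rat_eval_pderiv: "rat_eval (pderiv p) x = poly (pderiv (map_poly of_rat p)) x"
proof -
  have "map_poly of_rat (pderiv p) = pderiv (map_poly of_rat p :: 'a poly)"
    by (intro poly_eqI) (simp add: coeff_map_poly coeff_pderiv of_rat_mult of_rat_add)
  then show ?thesis by (simp add: rat_eval_def)
qed

lemma rat_eval_eq_sum:
  assumes "degree p \<le> n"
  shows "rat_eval p x = (\<Sum>i\<le>n. of_rat (coeff p i) * x ^ i)"
  unfolding rat_eval_def poly_altdef using assms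
  by (intro sum.mono_neutral_cong_left) (auto simp: degree_map_poly coeff_map_poly coeff_eq_0)

text \<open>A relation, since the polynomial is fixed only up to a scalar; divisibility and
  coprimality are drawn from the least degree.\<close>

definition minimal_poly_of :: "'a::field_char_0 \<Rightarrow> rat poly \<Rightarrow> bool" where
  "minimal_poly_of x p \<longleftrightarrow> p \<noteq> 0 \<and> rat_eval p x = 0 \<and>
     (\<forall>q. q \<noteq> 0 \<longrightarrow> rat_eval q x = 0 \<longrightarrow> degree p \<le> degree q)"

lemma minimal_poly_exists: "\<exists>p. minimal_poly_of (x::'a::number_field) p"
proof -
  obtain p where "p \<noteq> 0 \<and> rat_eval p x = 0"
    using rational_poly_root[of x] unfolding rat_eval_def by blast
  from ex_has_least_nat[of "\<lambda>p. p \<noteq> 0 \<and> rat_eval p x = 0", OF this, of degree] show ?thesis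
    unfolding minimal_poly_of_def by blast
qed

lemma minimal_poly_degree_le:
  assumes "minimal_poly_of (x::'a::number_field) p"
  shows "degree p \<le> field_degree TYPE('a)"
proof -
  obtain q where q: "q \<noteq> 0" "degree q \<le> field_degree TYPE('a)" "rat_eval q x = 0"
    using rational_poly_root[of x] unfolding rat_eval_def by blast
  then show ?thesis using assms unfolding minimal_poly_of_def by (meson order_trans)
qed

lemma minimal_poly_degree_pos:
  assumes "minimal_poly_of x p"
  shows "degree p > 0"
proof (rule ccontr)
  assume "\<not> degree p > 0"
  then obtain a where "p = [:a:]" by (auto elim: degree_eq_zeroE)
  then show False using assms by (simp add: minimal_poly_of_def)
qed

lemma minimal_poly_dvd:
  assumes p: "minimal_poly_of x p" and q: "rat_eval q x = 0"
  shows "p dvd q"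
proof -
  have "rat_eval (q mod p) x = 0"
    using p q rat_eval_add[of "q div p * p" "q mod p" x]
    by (simp add: rat_eval_mult minimal_poly_of_def)
  then have "q mod p = 0"
    using p degree_mod_less[of p q] unfolding minimal_poly_of_def by force
  then show ?thesis by (simp add: dvd_eq_mod_eq_0)
qed

text \<open>Since \<open>q\<close> does not vanish at \<open>x\<close>, neither does
  \<open>gcd q p\<close>, so its cofactor in \<open>p\<close> does. By minimality the cofactor has
  full degree, and the gcd is a unit.\<close>

lemma minimal_poly_bezout:
  assumes p: "minimal_poly_of x p" and q: "rat_eval q x \<noteq> 0"
  obtains a b where "a * q + b * p = 1"
proof -
  obtain h where h: "p = gcd q p * h" by (metis dvdE gcd_dvd2)
  obtain k where k: "q = gcd q p * k" by (metis dvdE gcd_dvd1)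
  have p0: "p \<noteq> 0" "rat_eval p x = 0" using p by (auto simp: minimal_poly_of_def)
  have "rat_eval (gcd q p) x \<noteq> 0"
    using q rat_eval_mult[of "gcd q p" k x] k by auto
  then have "rat_eval h x = 0"
    using p0(2) rat_eval_mult[of "gcd q p" h x] h by auto
  moreover have nz: "h \<noteq> 0" "gcd q p \<noteq> 0" using p0 h by auto
  ultimately have "degree p \<le> degree h" using p by (simp add: minimal_poly_of_def)
  moreover have "degree p = degree (gcd q p) + degree h"
    using nz h degree_mult_eq[of "gcd q p" h] by simp
  ultimately have "is_unit (gcd q p)"
    using nz(2) by (simp add: is_unit_iff_degree)
  then have "gcd q p = 1" by (simp only: is_unit_gcd_iff)
  then show ?thesis
    using that[of "fst (bezout_coefficients q p)" "snd (bezout_coefficients q p)"]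
      bezout_coefficients_fst_snd[of q p] by simp
qed

text \<open>
  Linear independence is an open condition: in coordinates dual to the family at \<open>0\<close>, the matrix of
  the family at a small \<open>c\<close> is strictly diagonally dominant.
\<close>

lemma independent_perturbation:
  fixes F :: "nat \<Rightarrow> 'a::number_field poly"
  assumes indep: "\<And>r. (\<Sum>i\<le>m. of_rat (r i) * coeff (F i) 0) = 0 \<Longrightarrow> \<forall>i\<le>m. r i = 0"
  obtains c :: rat where "c \<noteq> 0"
    "\<forall>r. (\<Sum>i\<le>m. of_rat (r i) * poly (F i) (of_rat c)) = 0 \<longrightarrow> (\<forall>i\<le>m. r i = 0)"
proof -
  define b where "b i = coeff (F i) 0" for i
  have inj: "inj_on b {..m}"
  proof (rule inj_onI, rule ccontr)
    fix i j assume ij: "i \<in> {..m}" "j \<in> {..m}" "b i = b j" "i \<noteq> j"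
    define r where "r k = (if k = i then 1 else 0) + (if k = j then -1 else (0::rat))" for k
    have "of_rat (r k) * b k = (if k = i then b k else 0) + (if k = j then - b k else 0)" for k
      by (auto simp: r_def)
    then have "(\<Sum>k\<le>m. of_rat (r k) * b k) = 0"
      using ij by (simp add: sum.distrib)
    then have "r i = 0" using indep[of r] ij by (simp add: b_def)
    then show False using ij by (simp add: r_def)
  qed
  define B where "B = b ` {..m}"
  have "Q.independent B"
    unfolding Q.independent_explicit
  proof (intro conjI allI impI ballI)
    fix u v assume u: "(\<Sum>v\<in>B. of_rat (u v) * v) = 0" "v \<in> B"
    then have "(\<Sum>i\<le>m. of_rat (u (b i)) * b i) = 0"
      using inj by (simp add: B_def sum.reindex)
    then have "\<forall>i\<le>m. u (b i) = 0" unfolding b_def by (rule indep)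
    then show "u v = 0" using u(2) by (auto simp: B_def)
  qed (simp add: B_def)
  define E where "E = Q.extend_basis B"
  have E: "Q.independent E" "Q.span E = UNIV" "B \<subseteq> E"
    using \<open>Q.independent B\<close>
    by (auto simp: E_def Q.independent_extend_basis Q.span_extend_basis Q.extend_basis_superset)
  \<comment> \<open>Coordinate functionals dual to the family \<open>b\<close>, read off in a basis
    of the whole field that extends it.\<close>
  define \<phi> where "\<phi> j x = Q.representation E x (b j)" for j x
  have \<phi>_scale: "\<phi> j (of_rat q * x) = q * \<phi> j x" for j q x
    using E by (simp add: \<phi>_def Q.representation_scale)
  have \<phi>_sum: "\<phi> j (sum f S) = (\<Sum>i\<in>S. \<phi> j (f i))" for j f and S :: "nat set"
    using E by (simp add: \<phi>_def Q.representation_sum)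
  have \<phi>_b: "\<phi> j (b i) = (if i = j then 1 else 0)" if "i \<le> m" "j \<le> m" for i j
    using that E inj inj_on_eq_iff[OF inj, of i j]
    by (auto simp: \<phi>_def B_def Q.representation_basis subset_iff)
  \<comment> \<open>The coordinates of \<open>poly (F i) c\<close> as real polynomials in
    \<open>c\<close>, so that continuity on the real line applies.\<close>
  define h where "h i j t = (\<Sum>k\<le>degree (F i). real_of_rat (\<phi> j (coeff (F i) k)) * t ^ k)" for i j t
  have h_eq: "h i j (of_rat c) = of_rat (\<phi> j (poly (F i) (of_rat c)))" for i j c
  proof -
    have "poly (F i) (of_rat c) = (\<Sum>k\<le>degree (F i). of_rat (c ^ k) * coeff (F i) k)"
      by (simp add: poly_altdef of_rat_power mult.commute)
    then have "\<phi> j (poly (F i) (of_rat c)) = (\<Sum>k\<le>degree (F i). c ^ k * \<phi> j (coeff (F i) k))"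
      by (simp add: \<phi>_sum \<phi>_scale)
    then show ?thesis
      by (simp add: h_def of_rat_sum of_rat_mult of_rat_power mult.commute)
  qed
  have h_0: "h i j 0 = (if i = j then 1 else 0)" if "i \<le> m" "j \<le> m" for i j
    using h_eq[of i j 0] \<phi>_b[OF that] by (simp add: poly_0_coeff_0 b_def)
  \<comment> \<open>A coordinate sums over \<open>m + 1\<close> indices, so deviations below
    \<open>1 / (m + 1)\<close> together stay below the diagonal entry 1.\<close>
  have "\<forall>\<^sub>F n in sequentially. \<bar>h i j (inverse (real (Suc n))) - h i j 0\<bar> < 1 / (m + 1)" for i j
  proof -
    have "isCont (h i j) 0"
      unfolding h_def by (intro continuous_intros)
    then have "(\<lambda>n. h i j (inverse (real (Suc n)))) \<longlonglongrightarrow> h i j 0"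
      using LIMSEQ_inverse_real_of_nat by (rule isCont_tendsto_compose)
    then show ?thesis
      using tendstoD[of _ "h i j 0" sequentially "1 / (m + 1)"] by (simp add: dist_real_def)
  qed
  then have "\<forall>\<^sub>F n in sequentially. \<forall>i\<in>{..m}. \<forall>j\<in>{..m}.
      \<bar>h i j (inverse (real (Suc n))) - h i j 0\<bar> < 1 / (m + 1)"
    by (intro eventually_ball_finite ballI) auto
  then obtain n where n: "\<And>i j. i \<le> m \<Longrightarrow> j \<le> m \<Longrightarrow>
      \<bar>h i j (inverse (real (Suc n))) - h i j 0\<bar> < 1 / (m + 1)"
    unfolding eventually_sequentially by blast
  define c where "c = inverse (of_nat (Suc n) :: rat)"
  have c: "real_of_rat c = inverse (real (Suc n))"
    by (simp add: c_def of_rat_inverse of_rat_add)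
  have "\<forall>r. (\<Sum>i\<le>m. of_rat (r i) * poly (F i) (of_rat c)) = 0 \<longrightarrow> (\<forall>i\<le>m. r i = 0)"
  proof (rule allI, rule impI)
    fix r assume r: "(\<Sum>i\<le>m. of_rat (r i) * poly (F i) (of_rat c)) = 0"
    \<comment> \<open>Reading the relation in the coordinate \<open>j\<close> of a largest
      coefficient would give \<open>M < M\<close> unless \<open>M = 0\<close>.\<close>
    define M where "M = Max ((\<lambda>i. \<bar>real_of_rat (r i)\<bar>) ` {..m})"
    have "M \<in> (\<lambda>i. \<bar>real_of_rat (r i)\<bar>) ` {..m}" unfolding M_def by (intro Max_in) auto
    then obtain j where j: "j \<le> m" "M = \<bar>real_of_rat (r j)\<bar>" by auto
    have M: "\<bar>real_of_rat (r i)\<bar> \<le> M" if "i \<le> m" for i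
      unfolding M_def using that by (intro Max_ge) auto
    have "(\<Sum>i\<le>m. r i * \<phi> j (poly (F i) (of_rat c))) = \<phi> j 0"
      by (simp add: r[symmetric] \<phi>_sum \<phi>_scale)
    also have "\<phi> j 0 = 0" using \<phi>_scale[of j 0 0] by simp
    finally have "real_of_rat (\<Sum>i\<le>m. r i * \<phi> j (poly (F i) (of_rat c))) = 0" by simp
    then have "(\<Sum>i\<le>m. real_of_rat (r i) * h i j (of_rat c)) = 0"
      by (simp add: of_rat_sum of_rat_mult h_eq)
    moreover have "(\<Sum>i\<le>m. real_of_rat (r i) * h i j 0) = real_of_rat (r j)"
    proof -
      have "(\<Sum>i\<le>m. real_of_rat (r i) * h i j 0) = (\<Sum>i\<le>m. if i = j then real_of_rat (r i) else 0)"
        using j(1) by (intro sum.cong) (auto simp: h_0)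
      then show ?thesis using j(1) by simp
    qed
    ultimately have eq: "real_of_rat (r j) = - (\<Sum>i\<le>m. real_of_rat (r i) * (h i j (of_rat c) - h i j 0))"
      by (simp add: right_diff_distrib sum_subtractf)
    have "M = 0"
    proof (rule ccontr)
      assume "M \<noteq> 0"
      then have "M > 0" using j by simp
      have "M \<le> (\<Sum>i\<le>m. \<bar>real_of_rat (r i) * (h i j (of_rat c) - h i j 0)\<bar>)"
        unfolding j(2) eq abs_minus_cancel by (rule sum_abs)
      also have "\<dots> < (\<Sum>i\<le>m. M * (1 / (m + 1)))"
      proof (rule sum_strict_mono)
        fix i assume i: "i \<in> {..m}"
        have "\<bar>real_of_rat (r i) * (h i j (of_rat c) - h i j 0)\<bar> \<le> M * \<bar>h i j (of_rat c) - h i j 0\<bar>"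
          using M[of i] i by (simp add: abs_mult mult_right_mono)
        also have "\<dots> < M * (1 / (m + 1))"
          using n[of i j] i j(1) \<open>M > 0\<close> unfolding c by (intro mult_strict_left_mono) auto
        finally show "\<bar>real_of_rat (r i) * (h i j (of_rat c) - h i j 0)\<bar> < M * (1 / (m + 1))" .
      qed auto
      also have "\<dots> = M" by simp
      finally show False by simp
    qed
    then show "\<forall>i\<le>m. r i = 0" using M by force
  qed
  moreover have "c \<noteq> 0" by (simp add: c_def del: of_nat_Suc)
  ultimately show ?thesis by (intro that)
qed

text \<open>
  Take \<open>\<theta>\<close> of maximal degree \<open>m\<close> with minimal polynomial \<open>P\<close>. If \<open>\<beta>\<close> were not in \<open>\<rat>(\<theta>)\<close>, then
  \<open>1, \<theta>, \<dots>, \<theta>\<^sup>m\<^sup>-\<^sup>1, P'(\<theta>) \<beta>\<close> would be independent. These are the values at \<open>c = 0\<close> of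
  \<open>1, \<theta> + c \<beta>, \<dots>, (\<theta> + c \<beta>)\<^sup>m\<^sup>-\<^sup>1, P(\<theta> + c \<beta>) / c\<close>, so \<open>\<theta> + c \<beta>\<close> would have degree above \<open>m\<close> for
  small \<open>c\<close>.
\<close>

lemma primitive_element:
  obtains \<theta> :: "'a::number_field" where "\<And>x. \<exists>q. x = rat_eval q \<theta>"
proof -
  obtain \<theta>0 :: 'a and p0 where "minimal_poly_of \<theta>0 p0" using minimal_poly_exists by blast
  then have "\<exists>\<theta>::'a. \<exists>p. minimal_poly_of \<theta> p \<and> degree p = degree p0" by blast
  moreover have "\<forall>d. (\<exists>\<theta>::'a. \<exists>p. minimal_poly_of \<theta> p \<and> degree p = d)
      \<longrightarrow> d \<le> field_degree TYPE('a)"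
    using minimal_poly_degree_le by blast
  ultimately obtain m where m: "\<exists>\<theta>::'a. \<exists>p. minimal_poly_of \<theta> p \<and> degree p = m"
    "\<And>d. \<exists>\<theta>::'a. \<exists>p. minimal_poly_of \<theta> p \<and> degree p = d \<Longrightarrow> d \<le> m"
    using GreatestI_nat[of "\<lambda>d. \<exists>\<theta>::'a. \<exists>p. minimal_poly_of \<theta> p \<and> degree p = d"]
      Greatest_le_nat[of "\<lambda>d. \<exists>\<theta>::'a. \<exists>p. minimal_poly_of \<theta> p \<and> degree p = d"]
    by (metis (no_types, lifting))
  obtain \<theta> :: 'a and P where P: "minimal_poly_of \<theta> P" "degree P = m" using m(1) by blast
  have "m > 0" using minimal_poly_degree_pos P by blast
  have low: "q = 0" if "rat_eval q \<theta> = 0" "degree q < m" for q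
    using P that unfolding minimal_poly_of_def by (meson linorder_not_le)
  have "\<exists>q. \<beta> = rat_eval q \<theta>" for \<beta>
  proof (rule ccontr)
    assume \<beta>: "\<nexists>q. \<beta> = rat_eval q \<theta>"
    define d where "d = rat_eval (pderiv P) \<theta>"
    have "d \<noteq> 0"
      using low[of "pderiv P"] \<open>m > 0\<close> P(2) by (auto simp: d_def degree_pderiv pderiv_eq_0_iff)
    \<comment> \<open>The inverse of \<open>d\<close> is again a polynomial in
      \<open>\<theta>\<close>, by Bezout for \<open>P\<close> and its derivative; so
      \<open>\<beta>\<close> would be one too.\<close>
    have u: "d * \<beta> \<noteq> rat_eval q \<theta>" for q
    proof
      assume eq: "d * \<beta> = rat_eval q \<theta>"
      obtain a b where "a * pderiv P + b * P = 1"
        using minimal_poly_bezout[OF P(1)] \<open>d \<noteq> 0\<close> unfolding d_def by blast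
      then have "rat_eval (a * pderiv P + b * P) \<theta> = 1" by simp
      then have "rat_eval a \<theta> * d = 1"
        using P(1) by (simp add: rat_eval_add rat_eval_mult d_def minimal_poly_of_def)
      then have "\<beta> = rat_eval a \<theta> * (d * \<beta>)" by (simp flip: mult.assoc)
      also have "\<dots> = rat_eval (a * q) \<theta>" by (simp add: eq rat_eval_mult)
      finally show False using \<beta> by blast
    qed
    \<comment> \<open>\<open>P(\<theta> + c \<beta>)\<close> as a polynomial in \<open>c\<close>.
      Its constant term is \<open>P(\<theta>) = 0\<close>, so \<open>c\<close> divides out, leaving
      \<open>R\<close> with constant term \<open>P'(\<theta>) \<beta>\<close>.\<close>
    define G where "G = pcompose (map_poly of_rat P) [:\<theta>, \<beta>:]"
    have G_eval: "poly G (of_rat c) = rat_eval P (\<theta> + of_rat c * \<beta>)" for c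
      by (simp add: G_def poly_pcompose rat_eval_def)
    have "poly G 0 = 0" using G_eval[of 0] P(1) by (simp add: minimal_poly_of_def)
    then obtain R where R: "G = pCons 0 R"
      by (cases G) auto
    have R0: "coeff R 0 = d * \<beta>"
    proof -
      have "coeff R 0 = poly (pderiv G) 0" by (simp add: R pderiv_pCons poly_0_coeff_0)
      also have "\<dots> = d * \<beta>"
        by (simp add: G_def pderiv_pcompose poly_pcompose d_def rat_eval_pderiv pderiv_pCons)
      finally show ?thesis .
    qed
    define F where "F i = (if i < m then [:\<theta>, \<beta>:] ^ i else R)" for i
    have F_0: "coeff (F i) 0 = (if i < m then \<theta> ^ i else d * \<beta>)" for i
      by (simp add: F_def R0 coeff_0_power)
    have split: "(\<Sum>i\<le>m. g i) = (\<Sum>i\<le>m - 1. g i) + g m" for g :: "nat \<Rightarrow> 'a"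
      using \<open>m > 0\<close> by (cases m) auto
    have indep: "\<forall>i\<le>m. r i = 0" if r: "(\<Sum>i\<le>m. of_rat (r i) * coeff (F i) 0) = 0" for r
    proof -
      define q where "q = (\<Sum>i\<le>m - 1. monom (r i) i)"
      have coeff_q: "coeff q i = (if i \<le> m - 1 then r i else 0)" for i
        by (simp add: q_def coeff_sum)
      have deg: "degree q \<le> m - 1" by (rule degree_le) (simp add: coeff_q)
      have "rat_eval q \<theta> = (\<Sum>i\<le>m - 1. of_rat (r i) * \<theta> ^ i)"
        unfolding rat_eval_eq_sum[OF deg] by (intro sum.cong) (auto simp: coeff_q)
      also have "\<dots> = (\<Sum>i\<le>m - 1. of_rat (r i) * coeff (F i) 0)"
        using \<open>m > 0\<close> by (intro sum.cong) (auto simp: F_0)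
      finally have sum0: "rat_eval q \<theta> + of_rat (r m) * (d * \<beta>) = 0"
        using r by (simp add: split F_0)
      have "r m = 0"
      proof (rule ccontr)
        assume rm: "r m \<noteq> 0"
        have "of_rat (r m) * (d * \<beta>) = - rat_eval q \<theta>"
          using sum0 by (simp add: eq_neg_iff_add_eq_0 add.commute)
        moreover have "d * \<beta> = of_rat (inverse (r m)) * (of_rat (r m) * (d * \<beta>))"
          using rm by (simp add: of_rat_inverse)
        ultimately have "d * \<beta> = of_rat (inverse (r m)) * - rat_eval q \<theta>"
          by (simp only:)
        also have "\<dots> = of_rat (- inverse (r m)) * rat_eval q \<theta>"
          by (simp add: of_rat_minus)
        also have "\<dots> = rat_eval (Polynomial.smult (- inverse (r m)) q) \<theta>"
          by (simp only: rat_eval_smult)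
        finally show False using u by blast
      qed
      then have "rat_eval q \<theta> = 0" using sum0 by simp
      then have "q = 0" using low[of q] deg \<open>m > 0\<close> by simp
      then have "r i = 0" if "i \<le> m - 1" for i using coeff_q[of i] that by simp
      then show ?thesis using \<open>r m = 0\<close> by (metis Suc_pred' \<open>m > 0\<close> le_Suc_eq)
    qed
    obtain c where c: "c \<noteq> 0"
      "\<forall>r. (\<Sum>i\<le>m. of_rat (r i) * poly (F i) (of_rat c)) = 0 \<longrightarrow> (\<forall>i\<le>m. r i = 0)"
      by (rule independent_perturbation[OF indep])
    define \<gamma> where "\<gamma> = \<theta> + of_rat c * \<beta>"
    have F_c: "poly (F i) (of_rat c) = \<gamma> ^ i" if "i < m" for i
      using that by (simp add: F_def \<gamma>_def)
    have R_c: "of_rat c * poly R (of_rat c) = rat_eval P \<gamma>"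
      using G_eval[of c] by (simp add: R \<gamma>_def)
    obtain p where p: "minimal_poly_of \<gamma> p" using minimal_poly_exists by blast
    then have p_deg: "degree p \<le> m" using m(2) by blast
    \<comment> \<open>Removes the term of degree \<open>m\<close> from \<open>p\<close>; then
      \<open>0 = p(\<gamma>) = q(\<gamma>) + s P(\<gamma>)\<close> is a relation in the perturbed
      family.\<close>
    define s where "s = coeff p m / lead_coeff P"
    define q where "q = p - Polynomial.smult s P"
    have "P \<noteq> 0" using P(1) by (simp add: minimal_poly_of_def)
    then have "coeff P m \<noteq> 0" unfolding P(2)[symmetric] by simp
    then have "coeff q m = 0" by (simp add: q_def s_def P(2))
    moreover have "degree q \<le> m"
      unfolding q_def using p_deg P(2) by (intro degree_diff_le) (auto intro: order_trans[OF degree_smult_le])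
    ultimately have "coeff q i = 0" if "m - 1 < i" for i
      using that coeff_eq_0[of q i] by (cases "i = m") auto
    then have q_deg: "degree q \<le> m - 1" by (simp add: degree_le)
    \<comment> \<open>The last member of the family is \<open>P(\<gamma>) / c\<close>, so the
      coefficient \<open>s\<close> of \<open>P(\<gamma>)\<close> is multiplied by
      \<open>c\<close>.\<close>
    define r where "r i = (if i < m then coeff q i else s * c)" for i
    have last: "of_rat (r m) * poly (F m) (of_rat c) = of_rat s * rat_eval P \<gamma>"
      unfolding R_c[symmetric] by (simp add: r_def F_def of_rat_mult)
    have "(\<Sum>i\<le>m. of_rat (r i) * poly (F i) (of_rat c))
        = (\<Sum>i\<le>m - 1. of_rat (r i) * poly (F i) (of_rat c)) + of_rat s * rat_eval P \<gamma>"
      by (simp only: split last)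
    also have "(\<Sum>i\<le>m - 1. of_rat (r i) * poly (F i) (of_rat c)) = rat_eval q \<gamma>"
      unfolding rat_eval_eq_sum[OF q_deg] using \<open>m > 0\<close>
      by (intro sum.cong) (auto simp: r_def F_c)
    also have "rat_eval q \<gamma> + of_rat s * rat_eval P \<gamma> = rat_eval p \<gamma>"
      by (simp add: q_def rat_eval_diff rat_eval_smult)
    also have "\<dots> = 0" using p by (simp add: minimal_poly_of_def)
    finally have r0: "\<forall>i\<le>m. r i = 0" by (rule mp[OF spec[OF c(2)]])
    then have "s = 0" using c(1) by (auto simp: r_def split: if_splits)
    moreover have "q = 0"
    proof (rule poly_eqI)
      fix i
      show "coeff q i = coeff 0 i"
      proof (cases "i < m")
        case True
        then show ?thesis using r0[rule_format, of i] by (simp add: r_def)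
      next
        case False
        then show ?thesis using q_deg \<open>m > 0\<close> by (simp add: coeff_eq_0)
      qed
    qed
    ultimately have "p = 0" by (simp add: q_def)
    then show False using p by (simp add: minimal_poly_of_def)
  qed
  then show ?thesis using that by blast
qed

section \<open>Counting the embeddings\<close>

lemma embedding_of_nat: "\<sigma> \<in> embeddings \<Longrightarrow> \<sigma> (of_nat k) = of_nat k"
  by (induction k) (simp_all add: embedding_0 embedding_1 embedding_add)

lemma embedding_of_int:
  assumes "\<sigma> \<in> embeddings"
  shows "\<sigma> (of_int k) = of_int k"
proof (cases k)
  case (neg n)
  have "\<sigma> (0 - of_nat (Suc n)) = 0 - of_nat (Suc n)"
    by (simp only: embedding_diff[OF assms] embedding_0[OF assms] embedding_of_nat[OF assms])
  then show ?thesis using neg by simp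
qed (simp add: embedding_of_nat[OF assms])

lemma embedding_of_rat:
  assumes "\<sigma> \<in> embeddings"
  shows "\<sigma> (of_rat q) = of_rat q"
proof (cases q)
  case (Fract a b)
  then have "of_rat q = (of_int a * inverse (of_int b) :: 'a)"
    "of_rat q = (of_int a * inverse (of_int b) :: complex)"
    by (simp_all add: of_rat_rat divide_inverse)
  then show ?thesis
    by (simp add: embedding_mult[OF assms] embedding_inverse[OF assms] embedding_of_int[OF assms])
qed

lemma embedding_rat_eval:
  assumes "\<sigma> \<in> embeddings"
  shows "\<sigma> (rat_eval p x) = rat_eval p (\<sigma> x)"
  by (induction p)
     (simp_all add: embedding_0[OF assms] embedding_add[OF assms] embedding_mult[OF assms]
       embedding_of_rat[OF assms])

text \<open>The embeddings correspond to the roots of the minimal polynomial of a primitive element.\<close>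

theorem card_embeddings:
  "finite (embeddings :: ('a::number_field \<Rightarrow> complex) set)"
  "card (embeddings :: ('a \<Rightarrow> complex) set) = field_degree TYPE('a)"
proof -
  let ?E = "embeddings :: ('a \<Rightarrow> complex) set"
  obtain \<theta> :: 'a where \<theta>: "\<And>x. \<exists>q. x = rat_eval q \<theta>" using primitive_element by blast
  obtain P where P: "minimal_poly_of \<theta> P" using minimal_poly_exists by blast
  then have P0: "P \<noteq> 0" "rat_eval P \<theta> = 0" by (auto simp: minimal_poly_of_def)
  define Pc where "Pc = (map_poly of_rat P :: complex poly)"
  have Pc: "Pc \<noteq> 0" "degree Pc = degree P"
    using P0 by (auto simp: Pc_def degree_map_poly map_poly_eq_0_iff)
  define Z where "Z = {\<rho>. poly Pc \<rho> = 0}"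
  have Z_iff: "\<rho> \<in> Z \<longleftrightarrow> rat_eval P \<rho> = 0" for \<rho> by (simp add: Z_def Pc_def rat_eval_def)
  have "finite Z" unfolding Z_def using Pc(1) by (rule poly_roots_finite)
  have "bij_betw (\<lambda>\<sigma>. \<sigma> \<theta>) ?E Z"
    unfolding bij_betw_def
  proof (intro conjI subset_antisym subsetI)
    show "inj_on (\<lambda>\<sigma>. \<sigma> \<theta>) ?E"
    proof (intro inj_onI ext)
      fix \<sigma> \<tau> :: "'a \<Rightarrow> complex" and x
      assume \<sigma>\<tau>: "\<sigma> \<in> embeddings" "\<tau> \<in> embeddings" "\<sigma> \<theta> = \<tau> \<theta>"
      obtain q where "x = rat_eval q \<theta>" using \<theta> by blast
      then show "\<sigma> x = \<tau> x" using \<sigma>\<tau> by (simp add: embedding_rat_eval)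
    qed
    show "\<rho> \<in> Z" if "\<rho> \<in> (\<lambda>\<sigma>. \<sigma> \<theta>) ` ?E" for \<rho>
      using that P0(2) embedding_0 by (auto simp: Z_iff simp flip: embedding_rat_eval)
    show "\<rho> \<in> (\<lambda>\<sigma>. \<sigma> \<theta>) ` ?E" if "\<rho> \<in> Z" for \<rho>
    proof -
      define rep where "rep x = (SOME q. x = rat_eval q \<theta>)" for x
      have rep: "rat_eval (rep x) \<theta> = x" for x
        unfolding rep_def using someI_ex[OF \<theta>[of x]] by simp
      define \<sigma> where "\<sigma> x = rat_eval (rep x) \<rho>" for x
      \<comment> \<open>Independence of the chosen polynomial: two polynomials with the same value
        at \<open>\<theta>\<close> differ by a multiple of \<open>P\<close>, which vanishes at
        \<open>\<rho>\<close>.\<close>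
      have \<sigma>: "\<sigma> (rat_eval q \<theta>) = rat_eval q \<rho>" for q
      proof -
        have "rat_eval (rep (rat_eval q \<theta>) - q) \<theta> = 0" by (simp add: rat_eval_diff rep)
        then obtain k where "rep (rat_eval q \<theta>) - q = P * k"
          using minimal_poly_dvd[OF P] by (auto elim: dvdE)
        then have "rat_eval (rep (rat_eval q \<theta>) - q) \<rho> = 0"
          using \<open>\<rho> \<in> Z\<close> by (simp add: rat_eval_mult Z_iff)
        then show ?thesis by (simp add: rat_eval_diff \<sigma>_def)
      qed
      have "\<sigma> 1 = 1" using \<sigma>[of 1] by simp
      moreover have "\<sigma> (x + y) = \<sigma> x + \<sigma> y" for x y
        using \<sigma>[of "rep x + rep y"] by (simp add: rat_eval_add rep \<sigma>_def)
      moreover have "\<sigma> (x * y) = \<sigma> x * \<sigma> y" for x y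
        using \<sigma>[of "rep x * rep y"] by (simp add: rat_eval_mult rep \<sigma>_def)
      moreover have "\<sigma> \<theta> = \<rho>" using \<sigma>[of "[:0, 1:]"] by simp
      ultimately show ?thesis by (intro image_eqI[of _ _ \<sigma>]) (auto simp: embeddings_def)
    qed
  qed
  then have fin: "finite ?E" and card: "card ?E = card Z"
    using \<open>finite Z\<close> by (auto simp: bij_betw_finite bij_betw_same_card)
  \<comment> \<open>Bezout for \<open>P\<close> and its derivative holds over the rationals; at a
    common complex root it would read 0 = 1.\<close>
  have "rsquarefree Pc"
    unfolding rsquarefree_roots
  proof (intro allI notI)
    fix \<rho> assume \<rho>: "poly Pc \<rho> = 0 \<and> poly (pderiv Pc) \<rho> = 0"
    have "rat_eval (pderiv P) \<theta> \<noteq> 0"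
    proof
      assume "rat_eval (pderiv P) \<theta> = 0"
      moreover have "pderiv P \<noteq> 0" using minimal_poly_degree_pos[OF P] by (simp add: pderiv_eq_0_iff)
      ultimately have "degree P \<le> degree (pderiv P)" using P by (simp add: minimal_poly_of_def)
      then show False using minimal_poly_degree_pos[OF P] by (simp add: degree_pderiv)
    qed
    then obtain a b where "a * pderiv P + b * P = 1" using minimal_poly_bezout[OF P] by blast
    then have "rat_eval (a * pderiv P + b * P) \<rho> = 1" by simp
    moreover have "rat_eval P \<rho> = 0" "rat_eval (pderiv P) \<rho> = 0"
      using \<rho> unfolding rat_eval_pderiv by (simp_all add: rat_eval_def Pc_def)
    ultimately show False by (simp add: rat_eval_add rat_eval_mult)
  qed
  from complex_poly_decompose_rsquarefree[OF this]
  have "degree Pc = degree (Polynomial.smult (lead_coeff Pc) (\<Prod>z\<in>Z. [:- z, 1:]))"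
    by (simp add: Z_def)
  also have "\<dots> = card Z"
    using Pc(1) by (simp add: degree_prod_eq_sum_degree)
  finally have card_Z: "card Z = degree P" using Pc(2) by simp
  \<comment> \<open>Reduction modulo \<open>P\<close> shows that these powers span, so n is at most
    \<open>degree P\<close>; the reverse bound holds for every minimal polynomial.\<close>
  define B where "B = (\<lambda>i. \<theta> ^ i) ` {..<degree P}"
  have "x \<in> Q.span B" for x
  proof -
    obtain q where q: "x = rat_eval q \<theta>" using \<theta> by blast
    have "q = q div P * P + q mod P" by simp
    then have "x = rat_eval (q mod P) \<theta>"
      using q rat_eval_add[of "q div P * P" "q mod P" \<theta>] P0(2) by (simp add: rat_eval_mult)
    also have "\<dots> = (\<Sum>i\<le>degree P - 1. of_rat (coeff (q mod P) i) * \<theta> ^ i)"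
      using degree_mod_less[OF P0(1), of q] by (intro rat_eval_eq_sum) auto
    also have "\<dots> \<in> Q.span B"
      using minimal_poly_degree_pos[OF P]
      by (intro Q.span_sum Q.span_scale Q.span_base) (auto simp: B_def)
    finally show ?thesis .
  qed
  then have "field_degree TYPE('a) \<le> card B"
    unfolding field_degree_def by (intro Q.dim_le_card) (auto simp: B_def)
  also have "card B \<le> degree P"
    unfolding B_def using card_image_le[of "{..<degree P}"] by simp
  finally have "field_degree TYPE('a) = degree P"
    using minimal_poly_degree_le[OF P] by simp
  then show "finite ?E" "card ?E = field_degree TYPE('a)"
    using fin card card_Z by simp_all
qed

section \<open>Reduced divisors\<close>

text \<open>The quotient of two such values is the scalar \<open>r\<close> of the estimate.\<close>

definition ideal_scale :: "'a::number_field set \<Rightarrow> real" where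
  "ideal_scale I = ideal_norm I powr (- 1 / real (field_degree TYPE('a)))"

lemma ideal_scale_pos: "fractional_ideal I \<Longrightarrow> ideal_scale I > 0"
  using ideal_norm_pos by (fastforce simp: ideal_scale_def)

lemma ideal_divisor_eq: "ideal_divisor I = (I, \<lambda>P\<in>infinite_primes. of_real (ideal_scale I))"
  by (simp add: ideal_divisor_def ideal_scale_def)

lemma ideal_divisor_translate:
  assumes "fractional_ideal I"
  shows "ideal_divisor I \<otimes>\<^bsub>oDiv\<^esub> (ring_of_integers, v)
    = (I, \<lambda>P\<in>infinite_primes. of_real (ideal_scale I) * v P)"
  by (auto simp: ideal_divisor_eq oDiv_simps ideal_mult_ring_of_integers[OF assms] FR_mult_def
      intro!: restrict_ext)

lemma reduced_divisorsE:
  assumes "D \<in> reduced_divisors"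
  obtains I where "D = ideal_divisor I" "fractional_ideal I" "minimal_in I 1"
  using assms by (auto simp: reduced_divisors_def)

text \<open>Adding d(J) on both sides removes the inverse; the two components of d(I) + (f) = d(J) +
  (O, v) are then compared.\<close>

lemma linear_equivalence:
  fixes f :: "'a::number_field"
  assumes I: "fractional_ideal I" and J: "fractional_ideal J" and f: "f \<noteq> 0" and v: "v \<in> FR_units"
    and eq: "ideal_divisor I \<otimes>\<^bsub>oDiv\<^esub> inv\<^bsub>oDiv\<^esub> (ideal_divisor J) \<otimes>\<^bsub>oDiv\<^esub> principal_divisor f
      = (ring_of_integers, v)"
  shows "I = (*) f ` J"
    and "\<And>P. P \<in> infinite_primes \<Longrightarrow>
      prime_embedding P f = of_real (ideal_scale J / ideal_scale I) * v P"
proof -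
  interpret G: comm_group "oDiv :: 'a odivisor monoid" by (rule comm_group_oDiv)
  note carr = ideal_divisor_in_carrier[OF I] ideal_divisor_in_carrier[OF J]
    principal_divisor_in_carrier[OF f]
  have "ideal_divisor I \<otimes>\<^bsub>oDiv\<^esub> principal_divisor f
      = ideal_divisor J \<otimes>\<^bsub>oDiv\<^esub> inv\<^bsub>oDiv\<^esub> (ideal_divisor J)
        \<otimes>\<^bsub>oDiv\<^esub> (ideal_divisor I \<otimes>\<^bsub>oDiv\<^esub> principal_divisor f)"
    using carr by simp
  also have "\<dots> = ideal_divisor J \<otimes>\<^bsub>oDiv\<^esub>
      (ideal_divisor I \<otimes>\<^bsub>oDiv\<^esub> inv\<^bsub>oDiv\<^esub> (ideal_divisor J) \<otimes>\<^bsub>oDiv\<^esub> principal_divisor f)"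
    by (simp only: G.m_ac G.m_closed G.inv_closed carr)
  also have "\<dots> = (J, \<lambda>P\<in>infinite_primes. of_real (ideal_scale J) * v P)"
    unfolding eq by (rule ideal_divisor_translate[OF J])
  also have "ideal_divisor I \<otimes>\<^bsub>oDiv\<^esub> principal_divisor f
      = ((*) (inverse f) ` I, \<lambda>P\<in>infinite_primes. of_real (ideal_scale I) * prime_embedding P f)"
    by (auto simp: ideal_divisor_eq principal_divisor_def oDiv_simps ideal_mult_principal[OF I]
        FR_mult_def to_FR_def intro!: restrict_ext)
  finally have J_eq: "(*) (inverse f) ` I = J"
    and scale: "(\<lambda>P\<in>infinite_primes. of_real (ideal_scale I) * prime_embedding P f)
      = (\<lambda>P\<in>infinite_primes. of_real (ideal_scale J) * v P)"
    by (simp_all only: prod.inject)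
  show "I = (*) f ` J"
    unfolding J_eq[symmetric] image_image using f by (simp flip: mult.assoc)
  show "prime_embedding P f = of_real (ideal_scale J / ideal_scale I) * v P"
    if "P \<in> infinite_primes" for P
    using fun_cong[OF scale, of P] that ideal_scale_pos[OF I]
    by (simp add: field_simps)
qed

lemma unit_image:
  assumes I: "fractional_ideal I" and e: "e \<in> unit_group"
  shows "(*) e ` I = I"
proof (intro subset_antisym subsetI)
  fix x assume "x \<in> (*) e ` I"
  then show "x \<in> I" using e by (auto simp: unit_group_def intro: fractional_ideal_mult[OF I])
next
  fix x assume "x \<in> I"
  then have "inverse e * x \<in> I" "x = e * (inverse e * x)"
    using e by (auto simp: unit_group_def intro: fractional_ideal_mult[OF I])
  then show "x \<in> (*) e ` I" by blast
qed

text \<open>All weights are at least 1, so a bound on the norm is a bound at each prime.\<close>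

lemma cmod_le_FR_norm:
  assumes "P \<in> infinite_primes"
  shows "cmod (y P) \<le> FR_norm y"
proof -
  have "real 1 * (cmod (y P))\<^sup>2 \<le> real (prime_degree P) * (cmod (y P))\<^sup>2"
    by (intro mult_right_mono) (auto simp: prime_degree_def)
  also have "\<dots> \<le> (\<Sum>P\<in>infinite_primes. real (prime_degree P) * (cmod (y P))\<^sup>2)"
    by (rule member_le_sum[OF assms])
       (simp_all add: finite_infinite_primes card_embeddings)
  finally show ?thesis
    unfolding FR_norm_def by (intro real_le_rsqrt) simp
qed

text \<open>A strict bound on the infimum yields a witness once the set is nonempty. The
  coordinatewise \<open>Ln\<close> of \<open>v\<close>, with unit 1, is a member: positivity at real
  primes makes it real there.\<close>

lemma Pic_norm_lessD:
  assumes v: "v \<in> FR_conn" and less: "Pic_norm v < r"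
  obtains y e where "e \<in> unit_group" "e \<in> totally_positive"
    "FR_exp y = FR_mult v (to_FR e)" "FR_norm y < r"
proof -
  let ?Y = "{y \<in> FR. \<exists>e \<in> unit_group \<inter> totally_positive. FR_exp y = FR_mult v (to_FR e)}"
  define y where "y = (\<lambda>P\<in>infinite_primes. Ln (v P))"
  have v_units: "v P \<in> completion P" "v P \<noteq> 0" if "P \<in> infinite_primes" for P
    using v that by (auto simp: FR_conn_def FR_units_iff)
  have "Ln (v P) \<in> completion P" if P: "P \<in> infinite_primes" for P
  proof (cases "real_prime P")
    case True
    then have "v P = of_real (Re (v P))" "Re (v P) > 0"
      using v v_units[OF P] P by (auto simp: FR_conn_def completion_def)
    then have "Ln (v P) = of_real (ln (Re (v P)))" by (metis Ln_of_real)
    then show ?thesis by simp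
  qed (simp add: completion_def)
  then have "y \<in> FR" by (simp add: y_def FR_def)
  moreover have "FR_exp y = FR_mult v (to_FR 1)"
    by (auto simp: FR_exp_def FR_mult_def to_FR_def y_def v_units infinite_prime_eq embedding_1
        intro!: restrict_ext)
  moreover have "1 \<in> unit_group \<inter> (totally_positive :: 'a set)"
    by (auto simp: unit_group_def totally_positive_def infinite_prime_eq embedding_1)
  ultimately have "?Y \<noteq> {}" by blast
  then obtain y where "y \<in> ?Y" "FR_norm y < r"
    using less cInf_lessD[of "FR_norm ` ?Y" r] unfolding Pic_norm_def by blast
  then show ?thesis using that by blast
qed

text \<open>The common core of both versions of (i): \<open>e = 1\<close> with the principal
  logarithm, or the unit supplied by the Pic-norm. Passing from \<open>f\<close> to
  \<open>f * e\<close> turns \<open>v\<close> into \<open>exp y\<close> and keeps the ideals, as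
  \<open>e J = J\<close>.\<close>

theorem reduced_divisors_eq_if_close:
  fixes f :: "'a::number_field"
  assumes D: "D \<in> reduced_divisors" "D' \<in> reduced_divisors"
    and f: "f \<noteq> 0" and v: "v \<in> FR_units" and e: "e \<in> unit_group"
    and eq: "D \<otimes>\<^bsub>oDiv\<^esub> inv\<^bsub>oDiv\<^esub> D' \<otimes>\<^bsub>oDiv\<^esub> principal_divisor f = (ring_of_integers, v)"
    and exp_y: "\<And>P. P \<in> infinite_primes \<Longrightarrow> exp (y P) = v P * prime_embedding P e"
    and y: "\<And>P. P \<in> infinite_primes \<Longrightarrow> cmod (y P) < ln (4 / 3)"
  shows "D = D'"
proof -
  obtain I where I: "D = ideal_divisor I" "fractional_ideal I" "minimal_in I 1"
    using D(1) by (rule reduced_divisorsE)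
  obtain J where J: "D' = ideal_divisor J" "fractional_ideal J" "minimal_in J 1"
    using D(2) by (rule reduced_divisorsE)
  have IJ: "I = (*) f ` J" and scale: "\<And>P. P \<in> infinite_primes \<Longrightarrow>
      prime_embedding P f = of_real (ideal_scale J / ideal_scale I) * v P"
    using linear_equivalence[OF I(2) J(2) f v] eq unfolding I(1) J(1) by blast+
  have "(*) (f * e) ` J = (*) f ` (*) e ` J" by (simp add: image_image mult.assoc)
  then have IJ': "I = (*) (f * e) ` J" using IJ unit_image[OF J(2) e] by simp
  have "f * e = 1"
  proof (rule minimal_multiplier_eq_1[OF I(2,3) J(3) _ IJ' _ _ y])
    show "f * e \<noteq> 0" using f e by (simp add: unit_group_def)
    show "ideal_scale J / ideal_scale I > 0" using ideal_scale_pos[OF I(2)] ideal_scale_pos[OF J(2)] by simp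
    show "prime_embedding P (f * e) = of_real (ideal_scale J / ideal_scale I) * exp (y P)"
      if P: "P \<in> infinite_primes" for P
      using scale[OF P] exp_y[OF P] embedding_mult[OF infinite_prime_eq(1)[OF P]] by simp
  qed
  then show ?thesis using IJ' by (simp add: I J)
qed

text \<open>The prime degrees add up to n, so the scalar N(I)^(-1/n) contributes its n-th power to
  the product and cancels N(I).\<close>

lemma translate_in_oDiv0:
  fixes I :: "'a::number_field set"
  assumes I: "fractional_ideal I" and v: "v \<in> FR_conn0"
  shows "ideal_divisor I \<otimes>\<^bsub>oDiv\<^esub> (ring_of_integers, v) \<in> carrier oDiv0"
proof -
  interpret G: comm_group "oDiv :: 'a odivisor monoid" by (rule comm_group_oDiv)
  let ?P = "infinite_primes :: ('a \<Rightarrow> complex) set set" and ?n = "field_degree TYPE('a)"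
  have v': "v \<in> FR_units" "(\<Prod>P\<in>?P. cmod (v P) ^ prime_degree P) = 1"
    using v by (auto simp: FR_conn0_def FR_conn_def)
  have "(\<Prod>P\<in>?P. cmod (of_real (ideal_scale I) * v P) ^ prime_degree P)
      = (\<Prod>P\<in>?P. ideal_scale I ^ prime_degree P) * (\<Prod>P\<in>?P. cmod (v P) ^ prime_degree P)"
    using ideal_scale_pos[OF I]
    by (simp add: norm_mult power_mult_distrib prod.distrib)
  also have "\<dots> = ideal_scale I ^ ?n"
    using sum_prime_degree[where 'a = 'a] card_embeddings[where 'a = 'a]
    by (simp add: v'(2) flip: power_sum)
  also have "\<dots> = ideal_norm I powr (- 1 / real ?n * real ?n)"
    using ideal_norm_pos[OF I] by (simp add: ideal_scale_def powr_powr flip: powr_realpow)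
  also have "\<dots> = inverse (ideal_norm I)"
    using ideal_norm_pos[OF I] field_degree_pos[where 'a = 'a] by (simp add: powr_minus)
  finally have prod: "(\<Prod>P\<in>?P. cmod (of_real (ideal_scale I) * v P) ^ prime_degree P)
      = inverse (ideal_norm I)" .
  have "ideal_divisor I \<otimes>\<^bsub>oDiv\<^esub> (ring_of_integers, v) \<in> carrier oDiv"
    using ideal_divisor_in_carrier[OF I] v'(1)
    by (intro G.m_closed) (simp_all add: oDiv_simps fractional_ideal_ring_of_integers)
  moreover have "divisor_degree (ideal_divisor I \<otimes>\<^bsub>oDiv\<^esub> (ring_of_integers, v)) = 0"
    using ideal_norm_pos[OF I] by (simp add: ideal_divisor_translate[OF I] divisor_degree_def prod)
  ultimately show ?thesis by (simp add: oDiv0_def)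
qed

section \<open>Divisor classes and the proof of both parts\<close>

lemma divisor_class_eq:
  "divisor_class D = {principal_divisor f \<otimes>\<^bsub>oDiv\<^esub> D | f. f \<noteq> 0}"
  by (auto simp: divisor_class_def r_coset_def principal_divisors_def oDiv0_def)

text \<open>(1) is the neutral element, so \<open>E\<close> lies in its own coset and hence in that
  of \<open>E'\<close>.\<close>

lemma divisor_class_eqD:
  assumes E: "E \<in> carrier oDiv" and eq: "divisor_class E = divisor_class E'"
  obtains f where "f \<noteq> 0" "E = principal_divisor f \<otimes>\<^bsub>oDiv\<^esub> E'"
proof -
  interpret G: comm_group "oDiv :: 'a odivisor monoid" by (rule comm_group_oDiv)
  have "principal_divisor (1 :: 'a) = \<one>\<^bsub>oDiv\<^esub>"
    by (auto simp: principal_divisor_def oDiv_simps principal_ideal_def to_FR_def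
        infinite_prime_eq embedding_1 intro!: restrict_ext)
  then have "principal_divisor 1 \<otimes>\<^bsub>oDiv\<^esub> E = E" using E by simp
  then have "\<exists>f. E = principal_divisor f \<otimes>\<^bsub>oDiv\<^esub> E \<and> f \<noteq> (0 :: 'a)"
    by (intro exI[of _ 1] conjI) simp_all
  then have "E \<in> divisor_class E"
    unfolding divisor_class_eq by (rule CollectI)
  then have "E \<in> divisor_class E'" by (simp only: eq)
  then have "\<exists>f. E = principal_divisor f \<otimes>\<^bsub>oDiv\<^esub> E' \<and> f \<noteq> (0 :: 'a)"
    unfolding divisor_class_eq by (rule CollectD)
  then show ?thesis using that by (elim exE conjE)
qed

text \<open>The difference of the two logarithms serves as the exponent, and the two half radii add
  up to \<open>ln (4 / 3)\<close>. Once \<open>f = 1\<close> and the ideals agree, the equal scales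
  cancel and leave \<open>v = w\<close>.\<close>

theorem translates_disjoint:
  fixes v w :: "'a::number_field FR"
  assumes D: "D \<in> reduced_divisors" "D' \<in> reduced_divisors"
    and v: "v \<in> FR_conn0" "\<And>P. P \<in> infinite_primes \<Longrightarrow> cmod (Ln (v P)) < 1 / 2 * ln (4 / 3)"
    and w: "w \<in> FR_conn0" "\<And>P. P \<in> infinite_primes \<Longrightarrow> cmod (Ln (w P)) < 1 / 2 * ln (4 / 3)"
    and eq: "divisor_class (D \<otimes>\<^bsub>oDiv\<^esub> (ring_of_integers, v))
      = divisor_class (D' \<otimes>\<^bsub>oDiv\<^esub> (ring_of_integers, w))"
  shows "D = D'" "v = w"
proof -
  obtain I where I: "D = ideal_divisor I" "fractional_ideal I" "minimal_in I 1"
    using D(1) by (rule reduced_divisorsE)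
  obtain J where J: "D' = ideal_divisor J" "fractional_ideal J" "minimal_in J 1"
    using D(2) by (rule reduced_divisorsE)
  have units: "v \<in> FR_units" "w \<in> FR_units" using v(1) w(1) by (auto simp: FR_conn0_def FR_conn_def)
  then have nz: "v P \<noteq> 0" "w P \<noteq> 0" if "P \<in> infinite_primes" for P
    using that by (auto simp: FR_units_iff)
  have "D \<otimes>\<^bsub>oDiv\<^esub> (ring_of_integers, v) \<in> carrier oDiv"
    using translate_in_oDiv0[OF I(2) v(1)] by (simp add: I(1) oDiv0_def)
  then obtain f where f: "f \<noteq> 0"
    "D \<otimes>\<^bsub>oDiv\<^esub> (ring_of_integers, v) = principal_divisor f \<otimes>\<^bsub>oDiv\<^esub> (D' \<otimes>\<^bsub>oDiv\<^esub> (ring_of_integers, w))"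
    using eq by (rule divisor_class_eqD)
  have "(I, \<lambda>P\<in>infinite_primes. of_real (ideal_scale I) * v P) = principal_divisor f \<otimes>\<^bsub>oDiv\<^esub>
      (J, \<lambda>P\<in>infinite_primes. of_real (ideal_scale J) * w P)"
    using f(2) by (simp only: I(1) J(1) ideal_divisor_translate[OF I(2)] ideal_divisor_translate[OF J(2)])
  also have "\<dots> = ((*) (inverse f) ` J,
      \<lambda>P\<in>infinite_primes. prime_embedding P f * (of_real (ideal_scale J) * w P))"
    using ideal_mult_commute[of J "principal_ideal (inverse f)"] ideal_mult_principal[OF J(2)]
    by (auto simp: principal_divisor_def oDiv_simps FR_mult_def to_FR_def intro!: restrict_ext)
  finally have IJ: "I = (*) (inverse f) ` J"
    and scale: "(\<lambda>P\<in>infinite_primes. of_real (ideal_scale I) * v P)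
      = (\<lambda>P\<in>infinite_primes. prime_embedding P f * (of_real (ideal_scale J) * w P))"
    unfolding prod.inject by blast+
  have pos: "ideal_scale I > 0" "ideal_scale J > 0" using ideal_scale_pos[OF I(2)] ideal_scale_pos[OF J(2)] by auto
  \<comment> \<open>The multiplier from \<open>J\<close> to \<open>I\<close> is
    \<open>inverse f\<close>, because (f) carries the ideal generated by
    \<open>inverse f\<close>.\<close>
  have "inverse f = 1"
  proof (rule minimal_multiplier_eq_1[OF I(2,3) J(3) _ IJ])
    show "inverse f \<noteq> 0" using f(1) by simp
    show "ideal_scale J / ideal_scale I > 0" using pos by simp
    show "prime_embedding P (inverse f)
        = of_real (ideal_scale J / ideal_scale I) * exp (Ln (w P) - Ln (v P))"
      if P: "P \<in> infinite_primes" for P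
    proof -
      note \<sigma> = infinite_prime_eq(1)[OF P]
      have "of_real (ideal_scale I) * v P = prime_embedding P f * (of_real (ideal_scale J) * w P)"
        using fun_cong[OF scale, of P] P by simp
      moreover have "prime_embedding P f \<noteq> 0" using f(1) \<sigma> by (simp add: embedding_eq_0_iff)
      ultimately show ?thesis
        unfolding embedding_inverse[OF \<sigma>]
        using pos nz[OF P] by (simp add: exp_diff field_simps)
    qed
    show "cmod (Ln (w P) - Ln (v P)) < ln (4 / 3)" if P: "P \<in> infinite_primes" for P
      using norm_triangle_ineq4[of "Ln (w P)" "Ln (v P)"] v(2)[OF P] w(2)[OF P] by linarith
  qed
  then have f1: "f = 1" by simp
  then have "I = J" using IJ by simp
  then show "D = D'" by (simp add: I J)
  show "v = w"
  proof (rule FR_eqI)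
    fix P :: "('a \<Rightarrow> complex) set" assume P: "P \<in> infinite_primes"
    then show "v P = w P"
      using fun_cong[OF scale, of P] pos
      by (simp add: f1 \<open>I = J\<close> embedding_1[OF infinite_prime_eq(1)[OF P]])
  qed (use units in \<open>auto simp: FR_units_iff\<close>)
qed

text \<open>The disjoint union is a dependent sum, so injectivity covers translates of different
  centres as well as those of one centre.\<close>

theorem theorem7p7:
  shows
    "(\<forall>D \<in> (reduced_divisors :: 'a::number_field odivisor set). \<forall>D' \<in> reduced_divisors.
        ((\<exists>f \<in> totally_positive. \<exists>v \<in> FR_units.
            D \<otimes>\<^bsub>oDiv\<^esub> inv\<^bsub>oDiv\<^esub> D' \<otimes>\<^bsub>oDiv\<^esub> principal_divisor f = (ring_of_integers, v) \<and>
            (\<forall>P\<in>infinite_primes. cmod (Ln (v P)) < ln (4 / 3)))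
         \<longrightarrow> D = D') \<and>
        ((\<exists>f \<in> totally_positive. \<exists>v \<in> FR_units.
            D \<otimes>\<^bsub>oDiv\<^esub> inv\<^bsub>oDiv\<^esub> D' \<otimes>\<^bsub>oDiv\<^esub> principal_divisor f = (ring_of_integers, v) \<and>
            Pic_norm v < ln (4 / 3))
         \<longrightarrow> D = D'))
     \<and>
     (let S = (SIGMA D' : (reduced_divisors :: 'a odivisor set).
                 {D' \<otimes>\<^bsub>oDiv\<^esub> (ring_of_integers, v) | v.
                    v \<in> FR_conn0 \<and>
                    (\<forall>P\<in>infinite_primes. cmod (Ln (v P)) < 1 / 2 * ln (4 / 3))})
      in (\<lambda>(D', E). divisor_class E) \<in> S \<rightarrow> carrier oPic0 \<and>
         inj_on (\<lambda>(D', E). divisor_class E) S)"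
proof (rule conjI)
  show "\<forall>D \<in> (reduced_divisors :: 'a odivisor set). \<forall>D' \<in> reduced_divisors.
        ((\<exists>f \<in> totally_positive. \<exists>v \<in> FR_units.
            D \<otimes>\<^bsub>oDiv\<^esub> inv\<^bsub>oDiv\<^esub> D' \<otimes>\<^bsub>oDiv\<^esub> principal_divisor f = (ring_of_integers, v) \<and>
            (\<forall>P\<in>infinite_primes. cmod (Ln (v P)) < ln (4 / 3)))
         \<longrightarrow> D = D') \<and>
        ((\<exists>f \<in> totally_positive. \<exists>v \<in> FR_units.
            D \<otimes>\<^bsub>oDiv\<^esub> inv\<^bsub>oDiv\<^esub> D' \<otimes>\<^bsub>oDiv\<^esub> principal_divisor f = (ring_of_integers, v) \<and>
            Pic_norm v < ln (4 / 3))
         \<longrightarrow> D = D')"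
  proof (intro ballI conjI impI; elim bexE conjE)
    fix D D' :: "'a odivisor" and f v
    assume D: "D \<in> reduced_divisors" "D' \<in> reduced_divisors"
      and f: "f \<in> totally_positive" and v: "v \<in> FR_units"
      and eq: "D \<otimes>\<^bsub>oDiv\<^esub> inv\<^bsub>oDiv\<^esub> D' \<otimes>\<^bsub>oDiv\<^esub> principal_divisor f = (ring_of_integers, v)"
    have f0: "f \<noteq> 0" using f by (simp add: totally_positive_def)
    show "D = D'" if Ln_v: "\<forall>P\<in>infinite_primes. cmod (Ln (v P)) < ln (4 / 3)"
    proof (rule reduced_divisors_eq_if_close[OF D f0 v _ eq])
      show "1 \<in> unit_group" by (simp add: unit_group_def)
      show "exp (Ln (v P)) = v P * prime_embedding P 1" if P: "P \<in> infinite_primes" for P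
        using v P by (simp add: FR_units_iff embedding_1 infinite_prime_eq)
    qed (use Ln_v in blast)
    show "D = D'" if less: "Pic_norm v < ln (4 / 3)"
    proof -
      obtain I where I: "D = ideal_divisor I" "fractional_ideal I"
        using D(1) by (rule reduced_divisorsE)
      obtain J where J: "D' = ideal_divisor J" "fractional_ideal J"
        using D(2) by (rule reduced_divisorsE)
      \<comment> \<open>At a real prime \<open>v\<close> is a positive multiple of the totally
        positive \<open>f\<close>; this places \<open>v\<close> in \<open>FR_conn\<close>, where
        logarithms with real coordinates exist.\<close>
      have "Re (v P) > 0" if P: "P \<in> infinite_primes" "real_prime P" for P
      proof -
        have "Re (prime_embedding P f) = ideal_scale J / ideal_scale I * Re (v P)"
          using linear_equivalence(2)[OF I(2) J(2) f0 v eq[unfolded I(1) J(1)] P(1)] by simp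
        moreover have "Re (prime_embedding P f) > 0"
          using f P by (simp add: totally_positive_def)
        ultimately show ?thesis
          using ideal_scale_pos[OF I(2)] ideal_scale_pos[OF J(2)]
          by (simp add: zero_less_mult_iff zero_less_divide_iff)
      qed
      then have "v \<in> FR_conn" using v by (simp add: FR_conn_def)
      then obtain y e where ye: "e \<in> unit_group" "e \<in> totally_positive"
        "FR_exp y = FR_mult v (to_FR e)" "FR_norm y < ln (4 / 3)"
        using less by (rule Pic_norm_lessD)
      show ?thesis
      proof (rule reduced_divisors_eq_if_close[OF D f0 v ye(1) eq])
        show "exp (y P) = v P * prime_embedding P e" if P: "P \<in> infinite_primes" for P
          using fun_cong[OF ye(3), of P] P by (simp add: FR_exp_def FR_mult_def to_FR_def)
        show "cmod (y P) < ln (4 / 3)" if "P \<in> infinite_primes" for P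
          using cmod_le_FR_norm[OF that, of y] ye(4) by linarith
      qed
    qed
  qed
next
  define S where "S = (SIGMA D' : (reduced_divisors :: 'a odivisor set).
    {D' \<otimes>\<^bsub>oDiv\<^esub> (ring_of_integers, v) | v.
      v \<in> FR_conn0 \<and> (\<forall>P\<in>infinite_primes. cmod (Ln (v P)) < 1 / 2 * ln (4 / 3))})"
  have "divisor_class E \<in> carrier oPic0" if "(D, E) \<in> S" for D E
  proof -
    obtain v where v: "D \<in> reduced_divisors" "E = D \<otimes>\<^bsub>oDiv\<^esub> (ring_of_integers, v)" "v \<in> FR_conn0"
      using \<open>(D, E) \<in> S\<close> by (auto simp: S_def)
    obtain I where "D = ideal_divisor I" "fractional_ideal I" using v(1) by (rule reduced_divisorsE)
    then have "E \<in> carrier oDiv0" using v translate_in_oDiv0 by blast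
    then show ?thesis
      by (auto simp: oPic0_def FactGroup_def RCOSETS_def divisor_class_def)
  qed
  moreover have "inj_on (\<lambda>(D', E). divisor_class E) S"
  proof (rule inj_onI, clarify)
    fix D E D' E'
    assume DE: "(D, E) \<in> S" "(D', E') \<in> S" and eq: "divisor_class E = divisor_class E'"
    obtain v where v: "D \<in> reduced_divisors" "E = D \<otimes>\<^bsub>oDiv\<^esub> (ring_of_integers, v)" "v \<in> FR_conn0"
      "\<forall>P\<in>infinite_primes. cmod (Ln (v P)) < 1 / 2 * ln (4 / 3)"
      using DE(1) unfolding S_def by blast
    obtain w where w: "D' \<in> reduced_divisors" "E' = D' \<otimes>\<^bsub>oDiv\<^esub> (ring_of_integers, w)" "w \<in> FR_conn0"
      "\<forall>P\<in>infinite_primes. cmod (Ln (w P)) < 1 / 2 * ln (4 / 3)"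
      using DE(2) unfolding S_def by blast
    have "D = D'" "v = w"
      using translates_disjoint[OF v(1) w(1) v(3) bspec[OF v(4)] w(3) bspec[OF w(4)]]
        eq[unfolded v(2) w(2)] by blast+
    then show "D = D' \<and> E = E'" by (simp add: v(2) w(2))
  qed
  ultimately show "let S = (SIGMA D' : (reduced_divisors :: 'a odivisor set).
                 {D' \<otimes>\<^bsub>oDiv\<^esub> (ring_of_integers, v) | v.
                    v \<in> FR_conn0 \<and>
                    (\<forall>P\<in>infinite_primes. cmod (Ln (v P)) < 1 / 2 * ln (4 / 3))})
      in (\<lambda>(D', E). divisor_class E) \<in> S \<rightarrow> carrier oPic0 \<and>
         inj_on (\<lambda>(D', E). divisor_class E) S"
    unfolding S_def[symmetric] Let_def by auto
qed

end
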